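(* Let $\Omega\subseteq\mathbb{C}^n$ be a bounded domain, let $\mathcal{R}$ be an essentially normal Hilbert module over $A(\Omega)$, and let $U$ be an isometric module map on $\mathcal{R}$ such that $\bigcap_{k=0}^\infty U^k\mathcal{R}=\{0\}$. Then $\mathcal{R}$ is subnormal, that is, there exists a normal (reductive) Hilbert module $\mathcal{N}$ over $A(\Omega)$ with $\mathcal{R}$ as a submodule.
   Context: All Hilbert spaces are complex and separable. $A(\Omega)$ is the uniform closure, in the continuous functions on $\overline{\Omega}$, of the functions holomorphic in a neighborhood of $\overline{\Omega}$. A Hilbert module over $A(\Omega)$ is a Hilbert space with a unital bounded $A(\Omega)$-module action; $M_i$ denotes the operator of module multiplication by the coordinate function $z_i$. The module is essentially normal (essentially reductive) if all cross-commutators $[M_i^*,M_j]=M_i^*M_j-M_jM_i^*$, $1\le i,j\le n$, are compact; it is normal (reductive) if $M_1,\dots,M_n$ are commuting normal operators. A module map on $\mathcal{R}$ is a bounded operator commuting with the module action. "$\mathcal{R}$ is a submodule of $\mathcal{N}$" means $\mathcal{R}$ is (isometrically isomorphic, as a module, to) a closed subspace of $\mathcal{N}$ invariant under the module action. *)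

theory Defs
  imports "HOL-Analysis.Analysis"
begin

section \<open>Complex Hilbert spaces\<close>

text \<open>Inner products are linear in the first and conjugate linear in the second argument. The
  underlying real inner product is the real part, so norm and topology are those of
  \<^class>\<open>real_inner\<close>.\<close>

class chilbert_space = real_inner + complete_space +
  fixes scaleC :: "complex \<Rightarrow> 'a \<Rightarrow> 'a" (infixr \<open>*\<^sub>C\<close> 75)
    and cinner :: "'a \<Rightarrow> 'a \<Rightarrow> complex"
  assumes scaleC_add_right: "a *\<^sub>C (x + y) = a *\<^sub>C x + a *\<^sub>C y"
    and scaleC_add_left: "(a + b) *\<^sub>C x = a *\<^sub>C x + b *\<^sub>C x"
    and scaleC_scaleC: "a *\<^sub>C b *\<^sub>C x = (a * b) *\<^sub>C x"
    and scaleC_of_real: "complex_of_real r *\<^sub>C x = r *\<^sub>R x"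
    and cinner_commute: "cinner x y = cnj (cinner y x)"
    and cinner_add_left: "cinner (x + y) z = cinner x z + cinner y z"
    and cinner_scaleC_left: "cinner (a *\<^sub>C x) y = a * cinner x y"
    and inner_eq_Re_cinner: "inner x y = Re (cinner x y)"

subsection \<open>Square-summable sequences\<close>

typedef ell2 = "{x :: nat \<Rightarrow> complex. summable (\<lambda>n. (cmod (x n))\<^sup>2)}"
  by (rule exI[of _ "\<lambda>_. 0"]) simp

setup_lifting type_definition_ell2

lemma ell2_summable_add:
  fixes x y :: "nat \<Rightarrow> complex"
  assumes "summable (\<lambda>n. (cmod (x n))\<^sup>2)" "summable (\<lambda>n. (cmod (y n))\<^sup>2)"
  shows "summable (\<lambda>n. (cmod (x n + y n))\<^sup>2)"
proof (rule summable_comparison_test'[where N = 0])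
  show "summable (\<lambda>n. 2 * (cmod (x n))\<^sup>2 + 2 * (cmod (y n))\<^sup>2)"
    using assms by (intro summable_add summable_mult)
  fix n
  have "(cmod (x n + y n))\<^sup>2 \<le> (cmod (x n) + cmod (y n))\<^sup>2"
    by (intro power_mono norm_triangle_ineq) simp
  also have "\<dots> \<le> 2 * (cmod (x n))\<^sup>2 + 2 * (cmod (y n))\<^sup>2"
    using zero_le_power2[of "cmod (x n) - cmod (y n)"]
    by (simp add: power2_eq_square algebra_simps)
  finally show "norm ((cmod (x n + y n))\<^sup>2) \<le> 2 * (cmod (x n))\<^sup>2 + 2 * (cmod (y n))\<^sup>2"
    by simp
qed

lemma ell2_summable_scale:
  fixes x :: "nat \<Rightarrow> complex"
  assumes "summable (\<lambda>n. (cmod (x n))\<^sup>2)"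
  shows "summable (\<lambda>n. (cmod (c * x n))\<^sup>2)"
  using summable_mult[OF assms, of "(cmod c)\<^sup>2"] by (simp add: norm_mult power_mult_distrib)

lemma ell2_summable_mult:
  fixes x y :: "nat \<Rightarrow> complex"
  assumes "summable (\<lambda>n. (cmod (x n))\<^sup>2)" "summable (\<lambda>n. (cmod (y n))\<^sup>2)"
  shows "summable (\<lambda>n. x n * cnj (y n))"
proof (rule summable_comparison_test'[where N = 0])
  show "summable (\<lambda>n. (cmod (x n))\<^sup>2 + (cmod (y n))\<^sup>2)"
    using assms by (rule summable_add)
  fix n
  have "2 * (cmod (x n) * cmod (y n)) \<le> (cmod (x n))\<^sup>2 + (cmod (y n))\<^sup>2"
    using zero_le_power2[of "cmod (x n) - cmod (y n)"]
    by (simp add: power2_eq_square algebra_simps)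
  moreover have "0 \<le> cmod (x n) * cmod (y n)" by simp
  ultimately have "cmod (x n) * cmod (y n) \<le> (cmod (x n))\<^sup>2 + (cmod (y n))\<^sup>2" by linarith
  then show "norm (x n * cnj (y n)) \<le> (cmod (x n))\<^sup>2 + (cmod (y n))\<^sup>2"
    by (simp add: norm_mult)
qed

lemma ell2_suminf_cnj:
  fixes x y :: "nat \<Rightarrow> complex"
  assumes "summable (\<lambda>n. (cmod (x n))\<^sup>2)" "summable (\<lambda>n. (cmod (y n))\<^sup>2)"
  shows "(\<Sum>n. x n * cnj (y n)) = cnj (\<Sum>n. y n * cnj (x n))"
proof -
  have "(\<lambda>n. cnj (y n * cnj (x n))) sums cnj (\<Sum>n. y n * cnj (x n))"
    by (rule sums_cnj[THEN iffD2, OF summable_sums[OF ell2_summable_mult[OF assms(2,1)]]])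
  moreover have "(\<lambda>n. cnj (y n * cnj (x n))) = (\<lambda>n. x n * cnj (y n))"
    by (rule ext) (simp only: complex_cnj_mult complex_cnj_cnj mult.commute)
  ultimately show ?thesis by (metis sums_unique)
qed

lemma ell2_suminf_add:
  fixes x y z :: "nat \<Rightarrow> complex"
  assumes "summable (\<lambda>n. (cmod (x n))\<^sup>2)" "summable (\<lambda>n. (cmod (y n))\<^sup>2)"
    "summable (\<lambda>n. (cmod (z n))\<^sup>2)"
  shows "(\<Sum>n. (x n + y n) * cnj (z n)) = (\<Sum>n. x n * cnj (z n)) + (\<Sum>n. y n * cnj (z n))"
  unfolding distrib_right
  by (rule suminf_add[symmetric]) (rule ell2_summable_mult; fact)+

lemma ell2_suminf_scale:
  fixes x y :: "nat \<Rightarrow> complex"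
  assumes "summable (\<lambda>n. (cmod (x n))\<^sup>2)" "summable (\<lambda>n. (cmod (y n))\<^sup>2)"
  shows "(\<Sum>n. c * x n * cnj (y n)) = c * (\<Sum>n. x n * cnj (y n))"
  unfolding mult.assoc by (rule suminf_mult[OF ell2_summable_mult[OF assms]])

instantiation ell2 :: real_inner
begin

lift_definition zero_ell2 :: ell2 is "\<lambda>_. 0" by simp
lift_definition plus_ell2 :: "ell2 \<Rightarrow> ell2 \<Rightarrow> ell2" is "\<lambda>x y n. x n + y n"
  by (rule ell2_summable_add)
lift_definition uminus_ell2 :: "ell2 \<Rightarrow> ell2" is "\<lambda>x n. - x n" by simp
lift_definition minus_ell2 :: "ell2 \<Rightarrow> ell2 \<Rightarrow> ell2" is "\<lambda>x y n. x n - y n"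
  using ell2_summable_add[where y = "\<lambda>n. - y n" for y] by simp
lift_definition scaleR_ell2 :: "real \<Rightarrow> ell2 \<Rightarrow> ell2" is "\<lambda>r x n. complex_of_real r * x n"
  by (rule ell2_summable_scale)
lift_definition inner_ell2 :: "ell2 \<Rightarrow> ell2 \<Rightarrow> real" is "\<lambda>x y. Re (\<Sum>n. x n * cnj (y n))" .

definition norm_ell2 :: "ell2 \<Rightarrow> real" where "norm_ell2 x = sqrt (inner x x)"
definition sgn_ell2 :: "ell2 \<Rightarrow> ell2" where "sgn_ell2 x = inverse (norm x) *\<^sub>R x"
definition dist_ell2 :: "ell2 \<Rightarrow> ell2 \<Rightarrow> real" where "dist_ell2 x y = norm (x - y)"
definition uniformity_ell2 :: "(ell2 \<times> ell2) filter"
  where "uniformity_ell2 = (INF e\<in>{0 <..}. principal {(x, y). dist x y < e})"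
definition open_ell2 :: "ell2 set \<Rightarrow> bool"
  where "open_ell2 U = (\<forall>x\<in>U. eventually (\<lambda>(x', y). x' = x \<longrightarrow> y \<in> U) uniformity)"

lemma ell2_inner_self_aux:
  fixes x :: "nat \<Rightarrow> complex"
  assumes "summable (\<lambda>n. (cmod (x n))\<^sup>2)"
  shows "Re (\<Sum>n. x n * cnj (x n)) = (\<Sum>n. (cmod (x n))\<^sup>2)"
proof -
  have "(\<lambda>n. complex_of_real ((cmod (x n))\<^sup>2)) sums complex_of_real (\<Sum>n. (cmod (x n))\<^sup>2)"
    by (rule sums_of_real[OF summable_sums[OF assms]])
  moreover have "(\<lambda>n. complex_of_real ((cmod (x n))\<^sup>2)) = (\<lambda>n. x n * cnj (x n))"
    by (rule ext) (rule complex_norm_square)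
  ultimately show ?thesis by (metis Re_complex_of_real sums_unique)
qed

instance
proof
  fix x y z :: ell2 and a b r :: real
  show "x + y + z = x + (y + z)" by transfer (simp add: algebra_simps)
  show "x + y = y + x" by transfer (simp add: algebra_simps)
  show "0 + x = x" by transfer simp
  show "- x + x = 0" by transfer simp
  show "x - y = x + - y" by transfer simp
  show "a *\<^sub>R (x + y) = a *\<^sub>R x + a *\<^sub>R y" by transfer (simp add: algebra_simps)
  show "(a + b) *\<^sub>R x = a *\<^sub>R x + b *\<^sub>R x" by transfer (simp add: algebra_simps)
  show "a *\<^sub>R b *\<^sub>R x = (a * b) *\<^sub>R x" by transfer (simp add: algebra_simps)
  show "1 *\<^sub>R x = x" by transfer simp
  show "sgn x = inverse (norm x) *\<^sub>R x" by (rule sgn_ell2_def)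
  show "dist x y = norm (x - y)" by (rule dist_ell2_def)
  show "uniformity = (INF e\<in>{0 <..}. principal {(x :: ell2, y). dist x y < e})"
    by (rule uniformity_ell2_def)
  show "open U = (\<forall>x\<in>U. eventually (\<lambda>(x', y). x' = x \<longrightarrow> y \<in> U) uniformity)" for U :: "ell2 set"
    by (rule open_ell2_def)
  show "inner x y = inner y x"
    by transfer (subst ell2_suminf_cnj, simp_all)
  show "inner (x + y) z = inner x z + inner y z"
    by transfer (simp only: ell2_suminf_add plus_complex.sel)
  show "inner (r *\<^sub>R x) y = r * inner x y"
    by transfer (simp only: ell2_suminf_scale Re_complex_of_real Im_complex_of_real times_complex.sel mult_zero_left diff_zero)
  show "0 \<le> inner x x"
    by transfer (simp add: ell2_inner_self_aux suminf_nonneg)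
  show "inner x x = 0 \<longleftrightarrow> x = 0"
    by transfer (simp add: ell2_inner_self_aux suminf_eq_zero_iff fun_eq_iff)
  show "norm x = sqrt (inner x x)" by (rule norm_ell2_def)
qed

end

lemma ell2_norm_square: "(norm (x :: ell2))\<^sup>2 = (\<Sum>n. (cmod (Rep_ell2 x n))\<^sup>2)"
proof -
  have "inner x x = (\<Sum>n. (cmod (Rep_ell2 x n))\<^sup>2)"
    by transfer (rule ell2_inner_self_aux)
  then show ?thesis by (simp add: power2_norm_eq_inner)
qed

lemma ell2_sum_le_norm: "(\<Sum>n<m. (cmod (Rep_ell2 x n))\<^sup>2) \<le> (norm x)\<^sup>2"
  unfolding ell2_norm_square using Rep_ell2[of x] by (intro sum_le_suminf) auto

instance ell2 :: complete_space
proof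
  fix X :: "nat \<Rightarrow> ell2"
  assume X: "Cauchy X"
  have coord: "cmod (Rep_ell2 x n) \<le> norm x" for x n
    by (rule power2_le_imp_le[OF _ norm_ge_zero])
      (rule order_trans[OF member_le_sum[of n "{..<Suc n}" "\<lambda>n. (cmod (Rep_ell2 x n))\<^sup>2"] ell2_sum_le_norm],
        auto)
  have "Cauchy (\<lambda>i. Rep_ell2 (X i) n)" for n
  proof (rule metric_CauchyI)
    fix e :: real assume "0 < e"
    then obtain M where M: "dist (X i) (X j) < e" if "i \<ge> M" "j \<ge> M" for i j
      using metric_CauchyD[OF X] by blast
    have "dist (Rep_ell2 (X i) n) (Rep_ell2 (X j) n) < e" if "i \<ge> M" "j \<ge> M" for i j
      using coord[of "X i - X j" n] M[OF that] by (simp add: dist_norm minus_ell2.rep_eq)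
    then show "\<exists>M. \<forall>i\<ge>M. \<forall>j\<ge>M. dist (Rep_ell2 (X i) n) (Rep_ell2 (X j) n) < e" by blast
  qed
  then have "\<forall>n. \<exists>l. (\<lambda>i. Rep_ell2 (X i) n) \<longlonglongrightarrow> l"
    by (simp add: Cauchy_convergent_iff convergent_def)
  then obtain l where "\<forall>n. (\<lambda>i. Rep_ell2 (X i) n) \<longlonglongrightarrow> l n"
    using choice[of "\<lambda>n l. (\<lambda>i. Rep_ell2 (X i) n) \<longlonglongrightarrow> l"] by blast
  then have l: "(\<lambda>i. Rep_ell2 (X i) n) \<longlonglongrightarrow> l n" for n by simp
  have bound: "\<exists>M. \<forall>i\<ge>M. summable (\<lambda>n. (cmod (Rep_ell2 (X i) n - l n))\<^sup>2) \<and>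
      (\<Sum>n. (cmod (Rep_ell2 (X i) n - l n))\<^sup>2) \<le> e\<^sup>2" if "0 < e" for e :: real
  proof -
    from that obtain M where M: "dist (X i) (X j) < e" if "i \<ge> M" "j \<ge> M" for i j
      using metric_CauchyD[OF X] by blast
    have part: "(\<Sum>n<m. (cmod (Rep_ell2 (X i) n - l n))\<^sup>2) \<le> e\<^sup>2" if "i \<ge> M" for i m
    proof (rule LIMSEQ_le_const2)
      show "(\<lambda>j. \<Sum>n<m. (cmod (Rep_ell2 (X i) n - Rep_ell2 (X j) n))\<^sup>2)
          \<longlonglongrightarrow> (\<Sum>n<m. (cmod (Rep_ell2 (X i) n - l n))\<^sup>2)"
        by (intro tendsto_intros l)
      have "(\<Sum>n<m. (cmod (Rep_ell2 (X i) n - Rep_ell2 (X j) n))\<^sup>2) \<le> e\<^sup>2" if "j \<ge> M" for j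
      proof -
        have "(\<Sum>n<m. (cmod (Rep_ell2 (X i) n - Rep_ell2 (X j) n))\<^sup>2) \<le> (norm (X i - X j))\<^sup>2"
          using ell2_sum_le_norm[of "X i - X j" m] by (simp add: minus_ell2.rep_eq)
        also have "\<dots> \<le> e\<^sup>2"
          using M[OF \<open>i \<ge> M\<close> that] by (intro power_mono) (auto simp: dist_norm)
        finally show ?thesis .
      qed
      then show "\<exists>N. \<forall>j\<ge>N. (\<Sum>n<m. (cmod (Rep_ell2 (X i) n - Rep_ell2 (X j) n))\<^sup>2) \<le> e\<^sup>2" by blast
    qed
    have "summable (\<lambda>n. (cmod (Rep_ell2 (X i) n - l n))\<^sup>2)" if "i \<ge> M" for i
      by (rule summableI_nonneg_bounded[OF _ part[OF that]]) simp
    then show ?thesis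
      using part by (intro exI[of _ M] allI impI conjI suminf_le_const) auto
  qed
  obtain M where "summable (\<lambda>n. (cmod (Rep_ell2 (X M) n - l n))\<^sup>2)"
    using bound[of 1] by auto
  then have "summable (\<lambda>n. (cmod (l n - Rep_ell2 (X M) n))\<^sup>2)"
    by (simp add: norm_minus_commute)
  from ell2_summable_add[OF this, of "Rep_ell2 (X M)"] Rep_ell2[of "X M"]
  have "summable (\<lambda>n. (cmod (l n))\<^sup>2)" by simp
  then have Rep_l: "Rep_ell2 (Abs_ell2 l) = l" by (simp add: Abs_ell2_inverse)
  have "X \<longlonglongrightarrow> Abs_ell2 l"
  proof (rule metric_LIMSEQ_I)
    fix e :: real assume "0 < e"
    then obtain M where M: "(\<Sum>n. (cmod (Rep_ell2 (X i) n - l n))\<^sup>2) \<le> (e / 2)\<^sup>2" if "i \<ge> M" for i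
      using bound[of "e / 2"] by auto
    have "dist (X i) (Abs_ell2 l) < e" if "i \<ge> M" for i
    proof -
      have "(norm (X i - Abs_ell2 l))\<^sup>2 \<le> (e / 2)\<^sup>2"
        using M[OF that] by (simp add: ell2_norm_square minus_ell2.rep_eq Rep_l)
      then have "norm (X i - Abs_ell2 l) \<le> e / 2"
        by (rule power2_le_imp_le) (use \<open>0 < e\<close> in simp)
      then show ?thesis using \<open>0 < e\<close> by (simp add: dist_norm)
    qed
    then show "\<exists>M. \<forall>i\<ge>M. dist (X i) (Abs_ell2 l) < e" by blast
  qed
  then show "convergent X" by (auto simp: convergent_def)
qed

instantiation ell2 :: chilbert_space
begin

lift_definition scaleC_ell2 :: "complex \<Rightarrow> ell2 \<Rightarrow> ell2" is "\<lambda>a x n. a * x n"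
  by (rule ell2_summable_scale)
lift_definition cinner_ell2 :: "ell2 \<Rightarrow> ell2 \<Rightarrow> complex" is "\<lambda>x y. \<Sum>n. x n * cnj (y n)" .

instance
proof
  fix x y z :: ell2 and a b :: complex and r :: real
  show "a *\<^sub>C (x + y) = a *\<^sub>C x + a *\<^sub>C y" by transfer (simp add: algebra_simps)
  show "(a + b) *\<^sub>C x = a *\<^sub>C x + b *\<^sub>C x" by transfer (simp add: algebra_simps)
  show "a *\<^sub>C b *\<^sub>C x = (a * b) *\<^sub>C x" by transfer (simp add: algebra_simps)
  show "complex_of_real r *\<^sub>C x = r *\<^sub>R x" by transfer simp
  show "cinner x y = cnj (cinner y x)"
    by transfer (rule ell2_suminf_cnj)
  show "cinner (x + y) z = cinner x z + cinner y z"
    by transfer (rule ell2_suminf_add)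
  show "cinner (a *\<^sub>C x) y = a * cinner x y"
    by transfer (rule ell2_suminf_scale)
  show "inner x y = Re (cinner x y)" by transfer simp
qed

end

section \<open>Operators on separable Hilbert spaces\<close>

text \<open>A separable Hilbert space is given as a closed complex subspace \<open>H\<close> of an ambient
  complete space, \<open>H = UNIV\<close> being allowed; operators on \<open>H\<close> are total functions of
  which only the values on \<open>H\<close> matter. Every separable Hilbert space is isometrically
  isomorphic to a closed subspace of \<^typ>\<open>ell2\<close>.\<close>

definition csubspace :: "'a :: chilbert_space set \<Rightarrow> bool" where
  "csubspace H \<longleftrightarrow>
     0 \<in> H \<and> (\<forall>x\<in>H. \<forall>y\<in>H. x + y \<in> H) \<and> (\<forall>c. \<forall>x\<in>H. c *\<^sub>C x \<in> H)"

definition separable_hilbert :: "'a :: chilbert_space set \<Rightarrow> bool" where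
  "separable_hilbert H \<longleftrightarrow> csubspace H \<and> closed H \<and> separable_space (top_of_set H)"

definition clinear_betw ::
  "'a :: chilbert_space set \<Rightarrow> 'b :: chilbert_space set \<Rightarrow> ('a \<Rightarrow> 'b) \<Rightarrow> bool" where
  "clinear_betw H K T \<longleftrightarrow> T \<in> H \<rightarrow> K \<and>
     (\<forall>x\<in>H. \<forall>y\<in>H. T (x + y) = T x + T y) \<and> (\<forall>c. \<forall>x\<in>H. T (c *\<^sub>C x) = c *\<^sub>C T x)"

definition bounded_operator :: "'a :: chilbert_space set \<Rightarrow> ('a \<Rightarrow> 'a) \<Rightarrow> bool" where
  "bounded_operator H T \<longleftrightarrow> clinear_betw H H T \<and> (\<exists>C. \<forall>x\<in>H. norm (T x) \<le> C * norm x)"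

definition adjoint_on :: "'a :: chilbert_space set \<Rightarrow> ('a \<Rightarrow> 'a) \<Rightarrow> 'a \<Rightarrow> 'a" where
  "adjoint_on H T y = (THE z. z \<in> H \<and> (\<forall>x\<in>H. cinner (T x) y = cinner x z))"

definition compact_operator :: "'a :: chilbert_space set \<Rightarrow> ('a \<Rightarrow> 'a) \<Rightarrow> bool" where
  "compact_operator H T \<longleftrightarrow>
     bounded_operator H T \<and> compact (closure (T ` {x \<in> H. norm x \<le> 1}))"

definition normal_operator :: "'a :: chilbert_space set \<Rightarrow> ('a \<Rightarrow> 'a) \<Rightarrow> bool" where
  "normal_operator H T \<longleftrightarrow> bounded_operator H T \<and>
     (\<forall>x\<in>H. adjoint_on H T (T x) = T (adjoint_on H T x))"

section \<open>The algebra of the domain\<close>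

definition bounded_domain :: "(complex ^ 'n) set \<Rightarrow> bool" where
  "bounded_domain \<Omega> \<longleftrightarrow> open \<Omega> \<and> connected \<Omega> \<and> \<Omega> \<noteq> {} \<and> bounded \<Omega>"

definition holomorphic_several :: "(complex ^ 'n \<Rightarrow> complex) \<Rightarrow> (complex ^ 'n) set \<Rightarrow> bool" where
  "holomorphic_several g V \<longleftrightarrow>
     (\<forall>z\<in>V. \<exists>D. (g has_derivative D) (at z) \<and> (\<forall>c v. D (c *s v) = c * D v))"

text \<open>The elements of \<open>A(\<Omega>)\<close> are functions on the closure of \<open>\<Omega>\<close>, hence extensional.\<close>

definition domain_algebra :: "(complex ^ 'n) set \<Rightarrow> (complex ^ 'n \<Rightarrow> complex) set" where
  "domain_algebra \<Omega> =
     {f \<in> extensional (closure \<Omega>). continuous_on (closure \<Omega>) f \<and>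
        (\<forall>e>0. \<exists>g V. open V \<and> closure \<Omega> \<subseteq> V \<and> holomorphic_several g V \<and>
           (\<forall>z\<in>closure \<Omega>. cmod (f z - g z) \<le> e))}"

definition alg_add ::
  "(complex ^ 'n) set \<Rightarrow> (complex ^ 'n \<Rightarrow> complex) \<Rightarrow> (complex ^ 'n \<Rightarrow> complex) \<Rightarrow> complex ^ 'n \<Rightarrow> complex"
  where "alg_add \<Omega> f g = (\<lambda>z\<in>closure \<Omega>. f z + g z)"

definition alg_mult ::
  "(complex ^ 'n) set \<Rightarrow> (complex ^ 'n \<Rightarrow> complex) \<Rightarrow> (complex ^ 'n \<Rightarrow> complex) \<Rightarrow> complex ^ 'n \<Rightarrow> complex"
  where "alg_mult \<Omega> f g = (\<lambda>z\<in>closure \<Omega>. f z * g z)"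

definition alg_scale ::
  "(complex ^ 'n) set \<Rightarrow> complex \<Rightarrow> (complex ^ 'n \<Rightarrow> complex) \<Rightarrow> complex ^ 'n \<Rightarrow> complex"
  where "alg_scale \<Omega> c f = (\<lambda>z\<in>closure \<Omega>. c * f z)"

definition alg_one :: "(complex ^ 'n) set \<Rightarrow> complex ^ 'n \<Rightarrow> complex"
  where "alg_one \<Omega> = (\<lambda>z\<in>closure \<Omega>. 1)"

definition coordinate :: "(complex ^ 'n) set \<Rightarrow> 'n \<Rightarrow> complex ^ 'n \<Rightarrow> complex"
  where "coordinate \<Omega> i = (\<lambda>z\<in>closure \<Omega>. z $ i)"

definition sup_norm :: "(complex ^ 'n) set \<Rightarrow> (complex ^ 'n \<Rightarrow> complex) \<Rightarrow> real"
  where "sup_norm \<Omega> f = (SUP z\<in>closure \<Omega>. cmod (f z))"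

section \<open>Hilbert modules\<close>

definition hilbert_module ::
  "(complex ^ 'n) set \<Rightarrow> 'a :: chilbert_space set \<Rightarrow> ((complex ^ 'n \<Rightarrow> complex) \<Rightarrow> 'a \<Rightarrow> 'a) \<Rightarrow> bool"
  where
  "hilbert_module \<Omega> H act \<longleftrightarrow> separable_hilbert H \<and>
     (\<forall>f\<in>domain_algebra \<Omega>. clinear_betw H H (act f)) \<and>
     (\<forall>x\<in>H. act (alg_one \<Omega>) x = x) \<and>
     (\<forall>c. \<forall>f\<in>domain_algebra \<Omega>. \<forall>x\<in>H. act (alg_scale \<Omega> c f) x = c *\<^sub>C act f x) \<and>
     (\<forall>f\<in>domain_algebra \<Omega>. \<forall>g\<in>domain_algebra \<Omega>. \<forall>x\<in>H.
        act (alg_add \<Omega> f g) x = act f x + act g x \<and>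
        act (alg_mult \<Omega> f g) x = act f (act g x)) \<and>
     (\<exists>C. \<forall>f\<in>domain_algebra \<Omega>. \<forall>x\<in>H. norm (act f x) \<le> C * sup_norm \<Omega> f * norm x)"

definition coordinate_op ::
  "(complex ^ 'n) set \<Rightarrow> ((complex ^ 'n \<Rightarrow> complex) \<Rightarrow> 'a \<Rightarrow> 'a) \<Rightarrow> 'n \<Rightarrow> 'a \<Rightarrow> 'a" where
  "coordinate_op \<Omega> act i = act (coordinate \<Omega> i)"

definition essentially_normal_module ::
  "(complex ^ 'n) set \<Rightarrow> 'a :: chilbert_space set \<Rightarrow> ((complex ^ 'n \<Rightarrow> complex) \<Rightarrow> 'a \<Rightarrow> 'a) \<Rightarrow> bool"
  where
  "essentially_normal_module \<Omega> H act \<longleftrightarrow> hilbert_module \<Omega> H act \<and>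
     (\<forall>i j. let M = coordinate_op \<Omega> act in
        compact_operator H
          (\<lambda>x. adjoint_on H (M i) (M j x) - M j (adjoint_on H (M i) x)))"

definition normal_module ::
  "(complex ^ 'n) set \<Rightarrow> 'a :: chilbert_space set \<Rightarrow> ((complex ^ 'n \<Rightarrow> complex) \<Rightarrow> 'a \<Rightarrow> 'a) \<Rightarrow> bool"
  where
  "normal_module \<Omega> H act \<longleftrightarrow> hilbert_module \<Omega> H act \<and>
     (let M = coordinate_op \<Omega> act in
        (\<forall>i. normal_operator H (M i)) \<and> (\<forall>i j. \<forall>x\<in>H. M i (M j x) = M j (M i x)))"

definition isometric_on :: "'a :: chilbert_space set \<Rightarrow> ('a \<Rightarrow> 'b :: chilbert_space) \<Rightarrow> bool" where
  "isometric_on H V \<longleftrightarrow> (\<forall>x\<in>H. norm (V x) = norm x)"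

definition module_map ::
  "(complex ^ 'n) set \<Rightarrow> 'a :: chilbert_space set \<Rightarrow> ((complex ^ 'n \<Rightarrow> complex) \<Rightarrow> 'a \<Rightarrow> 'a) \<Rightarrow>
     ('a \<Rightarrow> 'a) \<Rightarrow> bool" where
  "module_map \<Omega> H act U \<longleftrightarrow> bounded_operator H U \<and>
     (\<forall>f\<in>domain_algebra \<Omega>. \<forall>x\<in>H. U (act f x) = act f (U x))"

definition is_submodule ::
  "(complex ^ 'n) set \<Rightarrow> 'a :: chilbert_space set \<Rightarrow> ((complex ^ 'n \<Rightarrow> complex) \<Rightarrow> 'a \<Rightarrow> 'a) \<Rightarrow>
     'b :: chilbert_space set \<Rightarrow> ((complex ^ 'n \<Rightarrow> complex) \<Rightarrow> 'b \<Rightarrow> 'b) \<Rightarrow> bool" where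
  "is_submodule \<Omega> H act N act' \<longleftrightarrow>
     (\<exists>K V. K \<subseteq> N \<and> csubspace K \<and> closed K \<and> (\<forall>f\<in>domain_algebra \<Omega>. \<forall>x\<in>K. act' f x \<in> K) \<and>
        clinear_betw H K V \<and> bij_betw V H K \<and> isometric_on H V \<and>
        (\<forall>f\<in>domain_algebra \<Omega>. \<forall>x\<in>H. V (act f x) = act' f (V x)))"

text \<open>As \<^typ>\<open>ell2\<close> contains a copy of every separable Hilbert space, letting \<open>N\<close> range over its
  closed subspaces loses no generality.\<close>

definition subnormal_module ::
  "(complex ^ 'n) set \<Rightarrow> 'a :: chilbert_space set \<Rightarrow> ((complex ^ 'n \<Rightarrow> complex) \<Rightarrow> 'a \<Rightarrow> 'a) \<Rightarrow> bool"
  where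
  "subnormal_module \<Omega> H act \<longleftrightarrow>
     (\<exists>(N :: ell2 set) act'. normal_module \<Omega> N act' \<and> is_submodule \<Omega> H act N act')"

end

theory Submission
  imports Defs
begin

text \<open>The isometry \<open>U\<close> is pure, so it extends to a bilateral shift on the closure \<open>N\<close> of an increasing
  union of copies \<open>lift k ` R\<close> of \<open>R\<close>, where \<open>lift k x\<close> plays the role of \<open>U\<^sup>-\<^sup>k x\<close>; an operator \<open>S\<close> on
  \<open>R\<close> that commutes with \<open>U\<close> extends to an operator \<open>T\<close> on \<open>N\<close> with \<open>T (lift k x) = lift k (S x)\<close>
  and the same norm. Let \<open>S\<^sup>* S - S S\<^sup>*\<close> be compact. As \<open>U\<^sup>m x\<close> tends weakly to \<open>0\<close>, the difference of
  \<open>\<parallel>S U\<^sup>m x\<parallel>\<^sup>2 = \<parallel>S x\<parallel>\<^sup>2\<close> and \<open>\<parallel>S\<^sup>* U\<^sup>m x\<parallel>\<^sup>2\<close> tends to \<open>0\<close>. On the other hand \<open>\<parallel>S\<^sup>* U\<^sup>m x\<parallel>\<close> tends to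
  \<open>\<parallel>T\<^sup>* (lift k x)\<parallel>\<close>. Hence \<open>\<parallel>T\<^sup>* y\<parallel> = \<parallel>T y\<parallel>\<close> on a dense set, and \<open>T\<close> is normal.\<close>

section \<open>Inner products and linear maps\<close>

lemma cinner_add_right: "cinner x (y + z) = cinner x y + cinner x z"
  by (metis cinner_add_left cinner_commute complex_cnj_add)

lemma cinner_scaleC_right: "cinner x (a *\<^sub>C y) = cnj a * cinner x y"
  by (metis cinner_scaleC_left cinner_commute complex_cnj_mult)

lemma scaleC_minus_one: "(-1) *\<^sub>C x = - x"
  using scaleC_of_real[of "-1" x] by simp

lemma cinner_self: "cinner x x = complex_of_real ((norm x)\<^sup>2)"
proof -
  have "Im (cinner x x) = 0"
    using cinner_commute[of x x] by (metis complex_cnj_cancel_iff Reals_cnj_iff complex_is_Real_iff)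
  moreover have "Re (cinner x x) = (norm x)\<^sup>2"
    by (simp add: power2_norm_eq_inner inner_eq_Re_cinner)
  ultimately show ?thesis by (simp add: complex_eq_iff)
qed

lemma norm_scaleC: "norm (a *\<^sub>C x) = cmod a * norm x"
proof -
  have "cinner (a *\<^sub>C x) (a *\<^sub>C x) = (a * cnj a) * cinner x x"
    by (simp add: cinner_scaleC_left cinner_scaleC_right)
  then have "complex_of_real ((norm (a *\<^sub>C x))\<^sup>2) = complex_of_real ((cmod a * norm x)\<^sup>2)"
    unfolding cinner_self complex_norm_square[symmetric] by (simp add: power_mult_distrib)
  then show ?thesis unfolding of_real_eq_iff by (simp add: power2_eq_iff_nonneg)
qed

text \<open>Real Cauchy-Schwarz after a rotation: multiplying \<open>x\<close> by
  \<open>cnj (sgn c)\<close> turns the inner product \<open>c\<close> into the nonnegative real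
  \<open>cmod c\<close> and does not increase the norm of \<open>x\<close>.\<close>

lemma cmod_cinner_le: "cmod (cinner x y) \<le> norm x * norm y"
proof -
  define c where "c = cinner x y"
  have "cnj (sgn c) * c = complex_of_real ((cmod c)\<^sup>2 / cmod c)"
    unfolding sgn_eq of_real_divide complex_norm_square by simp
  also have "\<dots> = complex_of_real (cmod c)" by (simp add: power2_eq_square)
  finally have "cnj (sgn c) * c = complex_of_real (cmod c)" .
  then have "cmod c = Re (cinner (cnj (sgn c) *\<^sub>C x) y)"
    by (simp add: cinner_scaleC_left c_def)
  also have "\<dots> \<le> norm (cnj (sgn c) *\<^sub>C x) * norm y"
    using norm_cauchy_schwarz[of "cnj (sgn c) *\<^sub>C x" y] by (simp add: inner_eq_Re_cinner)
  also have "\<dots> \<le> norm x * norm y"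
    by (simp add: norm_scaleC norm_sgn mult_right_mono)
  finally show ?thesis by (simp add: c_def)
qed

text \<open>Sesquilinearity over the complex numbers is bilinearity over the reals, so the
  interpretation below supplies difference, limit and continuity rules.\<close>

lemma bounded_bilinear_cinner: "bounded_bilinear cinner"
proof
  fix r :: real and a b :: 'a
  show "cinner (r *\<^sub>R a) b = r *\<^sub>R cinner a b"
    by (simp add: scaleC_of_real[symmetric] cinner_scaleC_left scaleR_conv_of_real)
  show "cinner a (r *\<^sub>R b) = r *\<^sub>R cinner a b"
    by (simp add: scaleC_of_real[symmetric] cinner_scaleC_right scaleR_conv_of_real)
  show "\<exists>K. \<forall>a b :: 'a. norm (cinner a b) \<le> norm a * norm b * K"
    by (rule exI[of _ 1]) (simp add: cmod_cinner_le)
qed (simp_all add: cinner_add_left cinner_add_right)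

lemma bounded_bilinear_scaleC: "bounded_bilinear (*\<^sub>C)"
proof
  fix r :: real and a :: complex and b :: 'a
  show "(r *\<^sub>R a) *\<^sub>C b = r *\<^sub>R a *\<^sub>C b"
    by (simp add: scaleC_of_real[symmetric] scaleC_scaleC scaleR_conv_of_real)
  show "a *\<^sub>C r *\<^sub>R b = r *\<^sub>R a *\<^sub>C b"
    by (simp add: scaleC_of_real[symmetric] scaleC_scaleC mult.commute)
  show "\<exists>K. \<forall>a (b :: 'a). norm (a *\<^sub>C b) \<le> norm a * norm b * K"
    by (rule exI[of _ 1]) (simp add: norm_scaleC)
qed (simp_all add: scaleC_add_left scaleC_add_right)

interpretation cinner: bounded_bilinear cinner by (rule bounded_bilinear_cinner)
interpretation scaleC: bounded_bilinear "(*\<^sub>C)" by (rule bounded_bilinear_scaleC)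

lemmas [simp] = cinner.zero_left cinner.zero_right scaleC.zero_left scaleC.zero_right

section \<open>Complex subspaces and linear maps on them\<close>

lemma csubspace_zero: "csubspace H \<Longrightarrow> 0 \<in> H"
  and csubspace_add: "csubspace H \<Longrightarrow> x \<in> H \<Longrightarrow> y \<in> H \<Longrightarrow> x + y \<in> H"
  and csubspace_scaleC: "csubspace H \<Longrightarrow> x \<in> H \<Longrightarrow> c *\<^sub>C x \<in> H"
  by (auto simp: csubspace_def)

lemma csubspace_scaleR: "csubspace H \<Longrightarrow> x \<in> H \<Longrightarrow> r *\<^sub>R x \<in> H"
  by (metis csubspace_scaleC scaleC_of_real)

lemma csubspace_diff: "csubspace H \<Longrightarrow> x \<in> H \<Longrightarrow> y \<in> H \<Longrightarrow> x - y \<in> H"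
  using csubspace_add[of H x "(-1) *\<^sub>C y"] csubspace_scaleC[of H y "-1"]
  by (simp add: scaleC_minus_one)

lemmas csubspace_intros =
  csubspace_zero csubspace_add csubspace_scaleC csubspace_scaleR csubspace_diff

lemma csubspace_closure:
  assumes "csubspace D"
  shows "csubspace (closure D)"
  unfolding csubspace_def
proof (intro conjI ballI allI)
  show "0 \<in> closure D" using csubspace_zero[OF assms] closure_subset by blast
next
  fix x y assume "x \<in> closure D" "y \<in> closure D"
  then obtain f g where "\<And>n. f n \<in> D" "f \<longlonglongrightarrow> x" "\<And>n. g n \<in> D" "g \<longlonglongrightarrow> y"
    unfolding closure_sequential by blast
  then show "x + y \<in> closure D"
    unfolding closure_sequential
    by (intro exI[of _ "\<lambda>n. f n + g n"]) (auto intro: csubspace_add[OF assms] tendsto_add)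
next
  fix c x assume "x \<in> closure D"
  then obtain f where "\<And>n. f n \<in> D" "f \<longlonglongrightarrow> x"
    unfolding closure_sequential by blast
  then show "c *\<^sub>C x \<in> closure D"
    unfolding closure_sequential
    by (intro exI[of _ "\<lambda>n. c *\<^sub>C f n"])
      (auto intro: csubspace_scaleC[OF assms] scaleC.tendsto[OF tendsto_const])
qed

lemma clinear_betw_add:
  "clinear_betw H K T \<Longrightarrow> x \<in> H \<Longrightarrow> y \<in> H \<Longrightarrow> T (x + y) = T x + T y"
  and clinear_betw_scaleC: "clinear_betw H K T \<Longrightarrow> x \<in> H \<Longrightarrow> T (c *\<^sub>C x) = c *\<^sub>C T x"
  and clinear_betw_mem: "clinear_betw H K T \<Longrightarrow> x \<in> H \<Longrightarrow> T x \<in> K"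
  by (auto simp: clinear_betw_def)

lemma clinear_betw_diff:
  assumes "clinear_betw H K T" "csubspace H" "x \<in> H" "y \<in> H"
  shows "T (x - y) = T x - T y"
  using clinear_betw_add[OF assms(1,3), of "(-1) *\<^sub>C y"] clinear_betw_scaleC[OF assms(1,4), of "-1"]
    csubspace_scaleC[OF assms(2,4), of "-1"] by (simp add: scaleC_minus_one)

lemma clinear_betw_zero: "clinear_betw H K T \<Longrightarrow> csubspace H \<Longrightarrow> T 0 = 0"
  using clinear_betw_diff[of H K T 0 0] by (simp add: csubspace_zero)

lemma cinner_ext:
  assumes "csubspace H" "y \<in> H" "z \<in> H" "\<And>x. x \<in> H \<Longrightarrow> cinner x y = cinner x z"
  shows "y = z"
proof -
  have "cinner (y - z) (y - z) = 0"
    using assms(4)[OF csubspace_diff[OF assms(1-3)]] by (simp add: cinner.diff_right)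
  then show ?thesis by (simp add: cinner_self)
qed

text \<open>Polarization: norms of sums determine the real part, and replacing \<open>x\<close> by
  \<open>\<i> *\<^sub>C x\<close> gives the imaginary part. It serves for isometries, with
  \<open>T\<close> the identity, and later for an operator and its adjoint.\<close>

lemma cinner_clinear_cong:
  assumes S: "clinear_betw H K S" and T: "clinear_betw H L T" and H: "csubspace H"
    and eq: "\<And>x. x \<in> H \<Longrightarrow> norm (S x) = norm (T x)" and xy: "x \<in> H" "y \<in> H"
  shows "cinner (S x) (S y) = cinner (T x) (T y)"
proof -
  have Re: "Re (cinner (S u) (S v)) = Re (cinner (T u) (T v))" if "u \<in> H" "v \<in> H" for u v
  proof -
    have "norm (S u + S v) = norm (T u + T v)"
      using eq[OF csubspace_add[OF H that]] by (simp add: clinear_betw_add[OF S that] clinear_betw_add[OF T that])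
    then show ?thesis
      using that by (simp add: inner_eq_Re_cinner[symmetric] dot_norm eq)
  qed
  have "Im (cinner (S x) (S y)) = - Re (cinner (S (\<i> *\<^sub>C x)) (S y))"
    using clinear_betw_scaleC[OF S xy(1)] by (simp add: cinner_scaleC_left)
  also have "\<dots> = - Re (cinner (T (\<i> *\<^sub>C x)) (T y))"
    by (simp add: Re csubspace_scaleC[OF H] xy)
  also have "\<dots> = Im (cinner (T x) (T y))"
    using clinear_betw_scaleC[OF T xy(1)] by (simp add: cinner_scaleC_left)
  finally show ?thesis using Re[OF xy] by (simp add: complex_eq_iff)
qed

lemma clinear_isometric_cinner:
  assumes "clinear_betw H K V" "csubspace H" "isometric_on H V" "x \<in> H" "y \<in> H"
  shows "cinner (V x) (V y) = cinner x y"
  using cinner_clinear_cong[OF assms(1) _ assms(2) _ assms(4,5), of H "\<lambda>x. x"] assms(3)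
  by (simp add: clinear_betw_def isometric_on_def)

section \<open>Adjoints\<close>

text \<open>Direct method: a minimizing sequence in \<open>H\<close> is Cauchy, and the vanishing
  first variation at its limit gives the real part of the identity. Applying that to
  \<open>\<i> *\<^sub>C x\<close> gives the imaginary part.\<close>

lemma riesz_representation_on:
  fixes \<phi> :: "'a :: chilbert_space \<Rightarrow> complex"
  assumes H: "csubspace H" "closed H"
    and add: "\<And>x y. x \<in> H \<Longrightarrow> y \<in> H \<Longrightarrow> \<phi> (x + y) = \<phi> x + \<phi> y"
    and scale: "\<And>c x. x \<in> H \<Longrightarrow> \<phi> (c *\<^sub>C x) = c * \<phi> x"
    and bound: "\<And>x. x \<in> H \<Longrightarrow> cmod (\<phi> x) \<le> C * norm x"
  shows "\<exists>z\<in>H. \<forall>x\<in>H. \<phi> x = cinner x z"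
proof -
  \<comment> \<open>The representing vector is the minimizer of this functional.\<close>
  define J where "J x = (norm x)\<^sup>2 - 2 * Re (\<phi> x)" for x
  have scaleR: "\<phi> (r *\<^sub>R x) = r * \<phi> x" if "x \<in> H" for r x
    using scale[OF that, of "complex_of_real r"] by (simp add: scaleC_of_real)
  have diff: "\<phi> (x - y) = \<phi> x - \<phi> y" if "x \<in> H" "y \<in> H" for x y
    using add[OF that(1) csubspace_scaleR[OF H(1) that(2)], of "-1"] scaleR[OF that(2), of "-1"] by simp
  have below: "- (C\<^sup>2) \<le> J x" if "x \<in> H" for x
  proof -
    have "Re (\<phi> x) \<le> C * norm x"
      using bound[OF that] complex_Re_le_cmod order_trans by blast
    moreover have "0 \<le> (norm x - C)\<^sup>2" by simp
    ultimately show ?thesis by (simp add: J_def power2_diff algebra_simps)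
  qed
  define m where "m = Inf (J ` H)"
  have bdd: "bdd_below (J ` H)" using below by (intro bdd_belowI2)
  have mle: "m \<le> J x" if "x \<in> H" for x
    unfolding m_def by (rule cINF_lower[OF bdd that])
  have "\<exists>x\<in>H. J x < m + 1 / Suc n" for n
    using cINF_less_iff[OF _ bdd, of "m + 1 / Suc n"] csubspace_zero[OF H(1)]
    unfolding m_def by fastforce
  then obtain X where X: "\<And>n. X n \<in> H" "\<And>n. J (X n) < m + 1 / Suc n" by metis
  \<comment> \<open>Parallelogram law: the linear terms of \<open>J\<close> cancel against those at
    the midpoint, where \<open>J\<close> is still at least \<open>m\<close>.\<close>
  have par: "(norm (x - y))\<^sup>2 \<le> 2 * (J x + J y - 2 * m)" if "x \<in> H" "y \<in> H" for x y
  proof -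
    have mid: "(1/2) *\<^sub>R (x + y) \<in> H" using that H by (intro csubspace_intros)
    have "J ((1/2) *\<^sub>R (x + y)) = (norm (x + y))\<^sup>2 / 4 - Re (\<phi> x) - Re (\<phi> y)"
      using that by (simp add: J_def scaleR add csubspace_add[OF H(1)] power_divide add_divide_distrib)
    then have "2 * (J x + J y - 2 * J ((1/2) *\<^sub>R (x + y))) = 2 * (norm x)\<^sup>2 + 2 * (norm y)\<^sup>2 - (norm (x + y))\<^sup>2"
      by (simp add: J_def)
    also have "\<dots> = (norm (x - y))\<^sup>2"
      by (simp add: power2_norm_eq_inner inner_add inner_diff inner_commute)
    finally have "(norm (x - y))\<^sup>2 = 2 * (J x + J y - 2 * J ((1/2) *\<^sub>R (x + y)))" ..
    also have "\<dots> \<le> 2 * (J x + J y - 2 * m)"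
      by (intro mult_left_mono diff_left_mono mle mid) simp_all
    finally show ?thesis .
  qed
  have "Cauchy X"
  proof (rule metric_CauchyI)
    fix e :: real assume e: "0 < e"
    \<comment> \<open>By \<open>par\<close>, indices from \<open>N\<close> on have squared distance
      below \<open>4 / Suc N\<close>.\<close>
    obtain N where N: "1 / Suc N < e\<^sup>2 / 4" using e by (metis nat_approx_posE zero_less_power zero_less_divide_iff zero_less_numeral)
    have "dist (X i) (X j) < e" if "i \<ge> N" "j \<ge> N" for i j
    proof -
      have s: "1 / Suc k \<le> 1 / Suc N" if "k \<ge> N" for k using that by (simp add: frac_le)
      have "(norm (X i - X j))\<^sup>2 < e\<^sup>2"
        using par[OF X(1) X(1), of i j] X(2)[of i] X(2)[of j] s[OF that(1)] s[OF that(2)] N by argo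
      then show ?thesis using e by (simp add: dist_norm power2_less_imp_less)
    qed
    then show "\<exists>N. \<forall>i\<ge>N. \<forall>j\<ge>N. dist (X i) (X j) < e" by blast
  qed
  then obtain z where z: "X \<longlonglongrightarrow> z" using Cauchy_convergent_iff convergent_def by blast
  have zH: "z \<in> H" using H(2) X(1) z closed_sequentially by blast
  have "(\<lambda>n. \<phi> (X n) - \<phi> z) \<longlonglongrightarrow> 0"
  proof (rule Lim_null_comparison)
    show "\<forall>\<^sub>F n in sequentially. norm (\<phi> (X n) - \<phi> z) \<le> C * norm (X n - z)"
      using bound[OF csubspace_diff[OF H(1) X(1) zH]] by (simp add: diff X(1) zH)
    show "(\<lambda>n. C * norm (X n - z)) \<longlonglongrightarrow> 0"
      using z by (intro tendsto_mult_right_zero tendsto_norm_zero) (simp add: LIM_zero)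
  qed
  then have "(\<lambda>n. \<phi> (X n)) \<longlonglongrightarrow> \<phi> z" by (simp add: LIM_zero_iff)
  then have "(\<lambda>n. J (X n)) \<longlonglongrightarrow> J z" unfolding J_def using z by (intro tendsto_intros)
  moreover have "(\<lambda>n. m + 1 / Suc n) \<longlonglongrightarrow> m + 0"
    by (intro tendsto_intros LIMSEQ_Suc[OF lim_1_over_n])
  ultimately have Jz: "J z \<le> m" using X(2) by (intro LIMSEQ_le[of "\<lambda>n. J (X n)" _ "\<lambda>n. m + 1 / Suc n"]) (auto intro: less_imp_le)
  have Re: "Re (\<phi> h) = Re (cinner h z)" if h: "h \<in> H" for h
  proof -
    \<comment> \<open>\<open>2 * b\<close> is the derivative of \<open>J\<close> at \<open>z\<close>
      in direction \<open>h\<close>; a quadratic in \<open>t\<close> that vanishes at 0 and is never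
      negative has no linear term.\<close>
    define b where "b = inner h z - Re (\<phi> h)"
    have nn: "0 \<le> t\<^sup>2 * (norm h)\<^sup>2 + 2 * t * b" for t
    proof -
      have "z + t *\<^sub>R h \<in> H" using h zH H by (intro csubspace_intros)
      then have "J z \<le> J (z + t *\<^sub>R h)" using mle Jz by (meson order_trans)
      moreover have "J (z + t *\<^sub>R h) = J z + (t\<^sup>2 * (norm h)\<^sup>2 + 2 * t * b)"
        using h zH unfolding J_def b_def power2_norm_eq_inner
        by (simp add: add scaleR csubspace_scaleR[OF H(1)] inner_add inner_commute algebra_simps power2_eq_square)
      ultimately show ?thesis by linarith
    qed
    have "b = 0"
    proof (rule ccontr)
      assume b: "b \<noteq> 0"
      have p: "0 < (norm h)\<^sup>2 + 1" by (simp add: add_nonneg_pos)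
      \<comment> \<open>The choice \<open>t = - b / ((norm h)\<^sup>2 + 1)\<close> would make the
        quadratic negative; adding 1 keeps the denominator positive even for
        \<open>h = 0\<close>.\<close>
      have "(b / ((norm h)\<^sup>2 + 1))\<^sup>2 * (norm h)\<^sup>2 \<le> (b / ((norm h)\<^sup>2 + 1))\<^sup>2 * ((norm h)\<^sup>2 + 1)"
        by (intro mult_left_mono) auto
      also have "\<dots> = b\<^sup>2 / ((norm h)\<^sup>2 + 1)" using p by (simp add: power2_eq_square divide_simps)
      finally have "0 \<le> - (b\<^sup>2 / ((norm h)\<^sup>2 + 1))"
        using nn[of "- (b / ((norm h)\<^sup>2 + 1))"] by (simp add: power2_eq_square)
      moreover have "0 < b\<^sup>2 / ((norm h)\<^sup>2 + 1)" using b p by simp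
      ultimately show False by linarith
    qed
    then show ?thesis by (simp add: b_def inner_eq_Re_cinner)
  qed
  have "\<phi> x = cinner x z" if x: "x \<in> H" for x
    using Re[OF x] Re[OF csubspace_scaleC[OF H(1) x], of \<i>] scale[OF x, of \<i>]
    by (simp add: complex_eq_iff cinner_scaleC_left)
  then show ?thesis using zH by blast
qed

lemma bounded_operatorE:
  assumes "bounded_operator H T"
  obtains C where "C \<ge> 0" "\<And>x. x \<in> H \<Longrightarrow> norm (T x) \<le> C * norm x"
proof -
  obtain C where C: "\<And>x. x \<in> H \<Longrightarrow> norm (T x) \<le> C * norm x"
    using assms by (auto simp: bounded_operator_def)
  have "norm (T x) \<le> max C 0 * norm x" if "x \<in> H" for x
    using C[OF that] mult_right_mono[OF max.cobounded1[of C 0] norm_ge_zero[of x]] by linarith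
  then show ?thesis using that[of "max C 0"] by simp
qed

text \<open>Justifies the definite description in \<open>adjoint_on\<close>: the Riesz lemma
  represents the functional sending \<open>x\<close> to \<open>cinner (T x) y\<close>, and testing
  against \<open>H\<close> gives uniqueness.\<close>

lemma adjoint_on_exists:
  assumes H: "csubspace H" "closed H" and T: "bounded_operator H T" and y: "y \<in> H"
  shows "\<exists>!z. z \<in> H \<and> (\<forall>x\<in>H. cinner (T x) y = cinner x z)"
proof -
  obtain C where C: "\<And>x. x \<in> H \<Longrightarrow> norm (T x) \<le> C * norm x" using bounded_operatorE[OF T] by metis
  have lin: "clinear_betw H H T" using T by (simp add: bounded_operator_def)
  have "\<exists>z\<in>H. \<forall>x\<in>H. cinner (T x) y = cinner x z"
  proof (rule riesz_representation_on[OF H, where C = "C * norm y"])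
    fix x assume x: "x \<in> H"
    show "cmod (cinner (T x) y) \<le> C * norm y * norm x"
      using order_trans[OF cmod_cinner_le mult_right_mono[OF C[OF x] norm_ge_zero[of y]]]
      by (simp add: ac_simps)
    show "cinner (T (c *\<^sub>C x)) y = c * cinner (T x) y" for c
      by (simp add: clinear_betw_scaleC[OF lin x] cinner_scaleC_left)
    show "cinner (T (x + x')) y = cinner (T x) y + cinner (T x') y" if "x' \<in> H" for x'
      by (simp add: clinear_betw_add[OF lin x that] cinner_add_left)
  qed
  then show ?thesis using cinner_ext[OF H(1)] by metis
qed

lemma
  assumes "csubspace H" "closed H" "bounded_operator H T" "y \<in> H"
  shows adjoint_on_mem: "adjoint_on H T y \<in> H"
    and cinner_adjoint_on: "x \<in> H \<Longrightarrow> cinner (T x) y = cinner x (adjoint_on H T y)"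
  using theI'[OF adjoint_on_exists[OF assms]] by (auto simp: adjoint_on_def)

text \<open>The squared norm of the adjoint at \<open>y\<close> is the modulus of
  \<open>cinner (T (?A y)) y\<close>, so one factor cancels and the same \<open>C\<close> bounds the
  adjoint. In particular the adjoint of an isometry is a contraction.\<close>

lemma bounded_operator_adjoint_on:
  assumes H: "csubspace H" "closed H" and T: "bounded_operator H T"
    and C: "\<And>x. x \<in> H \<Longrightarrow> norm (T x) \<le> C * norm x"
  shows "bounded_operator H (adjoint_on H T)"
    and "y \<in> H \<Longrightarrow> norm (adjoint_on H T y) \<le> C * norm y"
proof -
  let ?A = "adjoint_on H T"
  note mem = adjoint_on_mem[OF H T] and adj = cinner_adjoint_on[OF H T]
  have bound: "norm (?A y) \<le> C * norm y" if y: "y \<in> H" for y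
  proof (cases "?A y = 0")
    case True
    then show ?thesis using C[OF y] order_trans[OF norm_ge_zero] by force
  next
    case False
    have "(norm (?A y))\<^sup>2 = cmod (cinner (T (?A y)) y)"
      by (simp add: adj[OF y mem[OF y]] cinner_self norm_power)
    also have "\<dots> \<le> C * norm (?A y) * norm y"
      by (rule order_trans[OF cmod_cinner_le mult_right_mono[OF C[OF mem[OF y]] norm_ge_zero]])
    finally have "norm (?A y) * norm (?A y) \<le> norm (?A y) * (C * norm y)"
      by (simp add: power2_eq_square ac_simps)
    then show ?thesis using False by simp
  qed
  show "y \<in> H \<Longrightarrow> norm (?A y) \<le> C * norm y" by (rule bound)
  have "?A (x + y) = ?A x + ?A y" if "x \<in> H" "y \<in> H" for x y
    by (rule cinner_ext[OF H(1)])
      (simp_all add: mem that csubspace_add[OF H(1)] cinner_add_right flip: adj)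
  moreover have "?A (c *\<^sub>C x) = c *\<^sub>C ?A x" if "x \<in> H" for c x
    by (rule cinner_ext[OF H(1)])
      (simp_all add: mem that csubspace_scaleC[OF H(1)] cinner_scaleC_right flip: adj)
  ultimately show "bounded_operator H ?A"
    using bound mem unfolding bounded_operator_def clinear_betw_def by blast
qed

section \<open>Continuity, density and compactness\<close>

lemma clinear_bounded_uniformly_continuous_on:
  assumes "clinear_betw H K T" "csubspace H" "\<And>x. x \<in> H \<Longrightarrow> norm (T x) \<le> C * norm x"
  shows "uniformly_continuous_on H T"
proof -
  have "dist (T x) (T y) \<le> max C 0 * dist x y" if "x \<in> H" "y \<in> H" for x y
    using assms(3)[OF csubspace_diff[OF assms(2) that]] clinear_betw_diff[OF assms(1,2) that]
      mult_right_mono[OF max.cobounded1[of C 0] norm_ge_zero[of "x - y"]]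
    by (simp add: dist_norm)
  then have "(max C 0)-lipschitz_on H T" by (intro lipschitz_onI) auto
  then show ?thesis by (rule lipschitz_on_uniformly_continuous)
qed

lemma continuous_on_closure_eqI:
  fixes f g :: "'a :: topological_space \<Rightarrow> 'b :: real_normed_vector"
  assumes "continuous_on (closure D) f" "continuous_on (closure D) g"
    and "\<And>x. x \<in> D \<Longrightarrow> f x = g x" "y \<in> closure D"
  shows "f y = g y"
  using continuous_constant_on_closure[OF continuous_on_diff[OF assms(1,2)], of 0 y] assms(3,4)
  by simp

text \<open>All \<open>K (u n)\<close> lie in a totally bounded set, hence near finitely many
  centres, and \<open>u n\<close> is eventually almost orthogonal to all of these at once.\<close>

lemma compact_operator_weak_null:
  assumes H: "csubspace H" "closed H" and K: "compact_operator H K"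
    and u: "\<And>n. u n \<in> H" "\<And>n. norm (u n) \<le> 1"
    and weak: "\<And>p. p \<in> H \<Longrightarrow> (\<lambda>n. cinner (u n) p) \<longlonglongrightarrow> 0"
  shows "(\<lambda>n. cinner (K (u n)) (u n)) \<longlonglongrightarrow> 0"
proof (rule LIMSEQ_I)
  fix e :: real assume e: "0 < e"
  let ?B = "closure (K ` {x \<in> H. norm x \<le> 1})"
  \<comment> \<open>Weak convergence is tested only against vectors of \<open>H\<close>, so the
    centres of the net must lie in \<open>H\<close>.\<close>
  have "K ` {x \<in> H. norm x \<le> 1} \<subseteq> H"
    using K by (auto simp: compact_operator_def bounded_operator_def clinear_betw_def)
  then have BH: "?B \<subseteq> H" using H(2) by (rule closure_minimal)
  have B: "seq_compact ?B"
    using K by (simp add: compact_operator_def compact_eq_seq_compact_metric)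
  obtain F where F: "finite F" "F \<subseteq> ?B" "?B \<subseteq> (\<Union>p\<in>F. ball p (e / 2))"
    using seq_compact_imp_totally_bounded[OF B, THEN spec, THEN mp, OF half_gt_zero[OF e]]
    by (elim exE conjE)
  have "\<forall>\<^sub>F n in sequentially. norm (cinner (u n) p) < e / 2" if "p \<in> F" for p
    using tendstoD[OF weak half_gt_zero[OF e]] that F(2) BH by (auto simp: dist_norm)
  then have "\<forall>\<^sub>F n in sequentially. \<forall>p\<in>F. norm (cinner (u n) p) < e / 2"
    using F(1) by (simp add: eventually_ball_finite)
  then obtain M where M: "\<And>n p. n \<ge> M \<Longrightarrow> p \<in> F \<Longrightarrow> norm (cinner (u n) p) < e / 2"
    unfolding eventually_sequentially by blast
  have "norm (cinner (K (u n)) (u n) - 0) < e" if n: "n \<ge> M" for n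
  proof -
    have "K (u n) \<in> ?B" using u closure_subset by fastforce
    then obtain p where p: "p \<in> F" "dist p (K (u n)) < e / 2" using F(3) by auto
    have "norm (cinner (K (u n)) (u n)) \<le> norm (cinner (K (u n) - p) (u n)) + norm (cinner p (u n))"
      using norm_triangle_ineq[of "cinner (K (u n) - p) (u n)" "cinner p (u n)"]
      by (simp add: cinner.diff_left)
    also have "norm (cinner (K (u n) - p) (u n)) \<le> norm (K (u n) - p) * 1"
      by (rule order_trans[OF cmod_cinner_le mult_left_mono[OF u(2)]]) simp
    also have "norm (cinner p (u n)) = norm (cinner (u n) p)"
      by (metis cinner_commute complex_mod_cnj)
    finally show ?thesis
      using M[OF n p(1)] p(2) by (simp add: dist_norm norm_minus_commute)
  qed
  then show "\<exists>M. \<forall>n\<ge>M. norm (cinner (K (u n)) (u n) - 0) < e" by blast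
qed

section \<open>Parseval frames\<close>

text \<open>Gram--Schmidt, recorded through the projections onto the orthogonal complements of the first
  \<open>n\<close> vectors. As \<open>sgn 0 = 0\<close>, linearly dependent vectors do no harm.\<close>

primrec residual :: "(nat \<Rightarrow> 'a :: chilbert_space) \<Rightarrow> nat \<Rightarrow> 'a \<Rightarrow> 'a" where
  "residual d 0 = (\<lambda>x. x)"
| "residual d (Suc n) = (\<lambda>x. residual d n x -
     cinner x (sgn (residual d n (d n))) *\<^sub>C sgn (residual d n (d n)))"

lemma residual_diff: "residual d n (x - y) = residual d n x - residual d n y"
  by (induction n) (simp_all add: cinner.diff_left scaleC.diff_left)

lemma residual_scaleC: "residual d n (c *\<^sub>C x) = c *\<^sub>C residual d n x"
  by (induction n) (simp_all add: cinner_scaleC_left scaleC.diff_right scaleC_scaleC)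

text \<open>Self-adjointness; with \<open>residual_idem\<close> it makes each residual map an
  orthogonal projection.\<close>

lemma cinner_residual: "cinner (residual d n x) y = cinner x (residual d n y)"
proof (induction n)
  case (Suc n)
  let ?e = "sgn (residual d n (d n))"
  have "cnj (cinner y ?e) = cinner ?e y" by (metis cinner_commute)
  then show ?case
    by (simp add: Suc cinner.diff_left cinner.diff_right cinner_scaleC_left cinner_scaleC_right)
qed simp

lemma residual_sgn: "residual d n (sgn x) = sgn (residual d n x)" if "norm (residual d n x) = norm x"
  using residual_scaleC[of d n "complex_of_real (inverse (norm x))" x] that
  unfolding scaleC_of_real sgn_div_norm by simp

text \<open>The new unit vector is fixed by the preceding projection, so a second pass removes
  nothing more. A zero vector leaves the projection unchanged.\<close>

lemma residual_idem: "residual d n (residual d n x) = residual d n x"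
proof (induction n arbitrary: x)
  case (Suc n)
  let ?v = "residual d n (d n)"
  have e: "residual d n (sgn ?v) = sgn ?v" using residual_sgn[of d n ?v] by (simp add: Suc)
  show ?case
  proof (cases "?v = 0")
    case False
    then have "cinner (sgn ?v) (sgn ?v) = 1" by (simp add: cinner_self norm_sgn)
    then show ?thesis
      by (simp add: residual_diff residual_scaleC Suc e cinner.diff_left cinner_scaleC_left
          cinner_residual)
  qed (simp add: Suc)
qed simp

text \<open>Bessel's inequality with its exact remainder: for a projection the squared norm is the
  inner product with \<open>x\<close>, and every step subtracts one squared coefficient.\<close>

lemma norm_residual:
  "(norm (residual d n x))\<^sup>2 = (norm x)\<^sup>2 - (\<Sum>i<n. (cmod (cinner x (sgn (residual d i (d i)))))\<^sup>2)"
proof (induction n)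
  case (Suc n)
  let ?v = "residual d n (d n)"
  have "complex_of_real ((norm (residual d (Suc n) x))\<^sup>2) = cinner x (residual d (Suc n) x)"
    by (simp only: cinner_self[symmetric] cinner_residual residual_idem)
  also have "\<dots> = cinner x (residual d n x) - cinner x (sgn ?v) * cnj (cinner x (sgn ?v))"
    by (simp add: cinner.diff_right cinner_scaleC_right)
  also have "cinner x (residual d n x) = complex_of_real ((norm (residual d n x))\<^sup>2)"
    by (simp only: cinner_self[symmetric] cinner_residual residual_idem)
  finally have "complex_of_real ((norm (residual d (Suc n) x))\<^sup>2) =
      complex_of_real ((norm (residual d n x))\<^sup>2 - (cmod (cinner x (sgn ?v)))\<^sup>2)"
    unfolding complex_norm_square[symmetric] of_real_diff .
  then show ?case unfolding of_real_eq_iff by (simp add: Suc)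
qed simp

lemma norm_residual_antimono:
  assumes "m \<le> n"
  shows "norm (residual d n x) \<le> norm (residual d m x)"
proof -
  have "(\<Sum>i<m. (cmod (cinner x (sgn (residual d i (d i)))))\<^sup>2)
      \<le> (\<Sum>i<n. (cmod (cinner x (sgn (residual d i (d i)))))\<^sup>2)"
    using assms by (intro sum_mono2) auto
  then have "(norm (residual d n x))\<^sup>2 \<le> (norm (residual d m x))\<^sup>2" by (simp add: norm_residual)
  then show ?thesis by (rule power2_le_imp_le) simp
qed

text \<open>The coefficient of \<open>d n\<close> along the normalized \<open>?v\<close> is
  \<open>norm ?v\<close>, so the term removed is \<open>?v\<close> itself.\<close>

lemma residual_self: "residual d (Suc n) (d n) = 0"
proof -
  let ?v = "residual d n (d n)"
  have "cinner (d n) (sgn ?v) = inverse (norm ?v) * cinner (residual d n (d n)) ?v"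
    by (simp add: sgn_div_norm cinner.scaleR_right cinner_residual residual_idem scaleR_conv_of_real)
  also have "\<dots> = complex_of_real (inverse (norm ?v) * (norm ?v)\<^sup>2)"
    by (simp add: cinner_self)
  also have "\<dots> = norm ?v" by (cases "?v = 0") (simp_all add: power2_eq_square)
  finally show ?thesis by (cases "?v = 0") (simp_all add: scaleC_of_real sgn_div_norm)
qed

text \<open>Gram--Schmidt applied to a dense sequence: the residuals of \<open>x\<close> tend to 0,
  which turns the remainder formula into Parseval's identity. Some frame vectors may be zero, so
  finite dimension needs no separate indexing.\<close>

lemma parseval_frame_exists:
  assumes "separable_space (top_of_set H)"
  shows "\<exists>f :: nat \<Rightarrow> 'a :: chilbert_space. \<forall>x\<in>H. (\<lambda>n. (cmod (cinner x (f n)))\<^sup>2) sums (norm x)\<^sup>2"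
\<comment> \<open>\<open>from_nat_into\<close> enumerates nonempty countable sets, so the empty set
  is split off.\<close>
proof (cases "H = {}")
  case False
  obtain S where S: "countable S" "S \<subseteq> H" "top_of_set H closure_of S = H"
    using assms by (auto simp: separable_space_def)
  then have "S \<noteq> {}" using False by auto
  have "H \<subseteq> closure S" using S(2,3) by (auto simp: closure_of_subtopology inf.absorb2)
  define d where "d = from_nat_into S"
  have d: "range d = S" unfolding d_def using \<open>S \<noteq> {}\<close> S(1) by (rule range_from_nat_into)
  have "(\<lambda>n. (cmod (cinner x (sgn (residual d n (d n)))))\<^sup>2) sums (norm x)\<^sup>2" if x: "x \<in> H" for x
  proof -
    have "(\<lambda>n. norm (residual d n x)) \<longlonglongrightarrow> 0"
    proof (rule LIMSEQ_I)
      fix e :: real assume "0 < e"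
      moreover have "x \<in> closure (range d)" using \<open>H \<subseteq> closure S\<close> x d by auto
      ultimately obtain n where n: "dist (d n) x < e" unfolding closure_approachable by blast
      \<comment> \<open>From \<open>Suc n\<close> on, the projections annihilate \<open>d n\<close>,
        and only the small vector \<open>x - d n\<close> survives.\<close>
      have "norm (residual d m x) < e" if "m \<ge> Suc n" for m
      proof -
        have "norm (residual d m (d n)) \<le> norm (residual d (Suc n) (d n))"
          by (rule norm_residual_antimono[OF that])
        then have "residual d m (d n) = 0" by (simp only: residual_self norm_zero norm_le_zero_iff)
        then have "norm (residual d m x) = norm (residual d m (x - d n))" by (simp add: residual_diff)
        also have "\<dots> \<le> norm (x - d n)" using norm_residual_antimono[of 0 m d "x - d n"] by simp
        finally show ?thesis using n by (simp add: dist_norm norm_minus_commute)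
      qed
      then show "\<exists>m0. \<forall>m\<ge>m0. norm (norm (residual d m x) - 0) < e" by auto
    qed
    from tendsto_diff[OF tendsto_const[of "(norm x)\<^sup>2"] tendsto_power[OF this, of 2]]
    show ?thesis by (simp add: sums_def norm_residual)
  qed
  then show ?thesis by (intro exI[of _ "\<lambda>n. sgn (residual d n (d n))"]) simp
qed simp

section \<open>Pure isometries\<close>

text \<open>Distances are preserved, so a convergent sequence of images pulls back to a Cauchy
  sequence, whose limit stays in the closed set \<open>H\<close>.\<close>

lemma closed_isometric_image:
  fixes V :: "'a :: chilbert_space \<Rightarrow> 'b :: chilbert_space"
  assumes V: "clinear_betw H K V" "isometric_on H V" and H: "csubspace H" "closed H"
  shows "closed (V ` H)"
proof -
  have nV: "norm (V x) = norm x" if "x \<in> H" for x using V(2) that by (simp add: isometric_on_def)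
  have dV: "dist (V x) (V y) = dist x y" if "x \<in> H" "y \<in> H" for x y
    using nV[OF csubspace_diff[OF H(1) that]] by (simp add: clinear_betw_diff[OF V(1) H(1) that] dist_norm)
  have "l \<in> V ` H" if y: "\<And>n. y n \<in> V ` H" "y \<longlonglongrightarrow> l" for y l
  proof -
    have "\<forall>n. \<exists>x. x \<in> H \<and> y n = V x" using y(1) by blast
    then obtain x where x: "\<And>n. x n \<in> H" "\<And>n. y n = V (x n)" by metis
    have "Cauchy y" using y(2) by (rule LIMSEQ_imp_Cauchy)
    then have "Cauchy x" by (simp add: Cauchy_def x dV)
    then obtain z where z: "x \<longlonglongrightarrow> z" using Cauchy_convergent_iff convergent_def by blast
    have zH: "z \<in> H" using x(1) z H(2) closed_sequentially by blast
    have "(\<lambda>n. dist (y n) (V z)) \<longlonglongrightarrow> 0"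
      using z by (simp add: x dV zH tendsto_dist_iff[of x])
    then have "y \<longlonglongrightarrow> V z" by (simp add: tendsto_dist_iff[of y])
    then show ?thesis using zH y(2) LIMSEQ_unique by blast
  qed
  then show ?thesis unfolding closed_sequential_limits by blast
qed

lemma clinear_betw_funpow: "clinear_betw H H T \<Longrightarrow> clinear_betw H H (T ^^ k)"
  by (induction k) (auto simp: clinear_betw_def Pi_def)

text \<open>The module action is left out: it enters through operators commuting with
  \<open>U\<close>.\<close>

locale pure_isometry =
  fixes R :: "'a :: chilbert_space set" and U :: "'a \<Rightarrow> 'a"
  assumes separable: "separable_hilbert R"
    and bounded_U: "bounded_operator R U"
    and isometric_U: "isometric_on R U"
    and pure: "(\<Inter>k. (U ^^ k) ` R) = {0}"
begin

lemma R: "csubspace R" "closed R"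
  using separable by (simp_all add: separable_hilbert_def)

lemma U_lin: "clinear_betw R R (U ^^ k)"
  using bounded_U by (intro clinear_betw_funpow) (simp add: bounded_operator_def)

lemma U_lin1: "clinear_betw R R U"
  using U_lin[of 1] by simp

lemmas U_mem = clinear_betw_mem[OF U_lin] and U_mem1 = clinear_betw_mem[OF U_lin1]

lemma norm_U: "x \<in> R \<Longrightarrow> norm ((U ^^ k) x) = norm x"
  using isometric_U U_mem by (induction k) (auto simp: isometric_on_def)

lemma norm_U1: "x \<in> R \<Longrightarrow> norm (U x) = norm x"
  using norm_U[of x 1] by simp

lemma cinner_U: "x \<in> R \<Longrightarrow> y \<in> R \<Longrightarrow> cinner ((U ^^ k) x) ((U ^^ k) y) = cinner x y"
  using norm_U by (intro clinear_isometric_cinner[OF U_lin R(1)]) (auto simp: isometric_on_def)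

definition A :: "'a \<Rightarrow> 'a" where "A = adjoint_on R U"

lemma A_lin: "clinear_betw R R (A ^^ k)"
  using bounded_operator_adjoint_on(1)[OF R bounded_U, of 1] norm_U1
  by (intro clinear_betw_funpow) (simp add: bounded_operator_def A_def)

lemma A_lin1: "clinear_betw R R A"
  using A_lin[of 1] by simp

lemmas A_mem = clinear_betw_mem[OF A_lin] and A_mem1 = clinear_betw_mem[OF A_lin1]

lemma norm_A_le: "x \<in> R \<Longrightarrow> norm (A x) \<le> norm x"
  using bounded_operator_adjoint_on(2)[OF R bounded_U, of 1 x] norm_U1 by (simp add: A_def)

lemma adjoint_A: "x \<in> R \<Longrightarrow> y \<in> R \<Longrightarrow> cinner ((U ^^ k) x) y = cinner x ((A ^^ k) y)"
proof (induction k arbitrary: y)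
  case (Suc k)
  have "cinner ((U ^^ Suc k) x) y = cinner ((U ^^ k) x) (A y)"
    using cinner_adjoint_on[OF R bounded_U Suc(3) U_mem[OF Suc(2)]] by (simp add: A_def)
  then show ?case by (simp add: Suc A_mem1 funpow_swap1)
qed simp

lemma A_U: "x \<in> R \<Longrightarrow> (A ^^ k) ((U ^^ k) x) = x"
  by (rule cinner_ext[OF R(1)]) (simp_all add: A_mem U_mem cinner_U flip: adjoint_A)

lemma A_U1: "x \<in> R \<Longrightarrow> A (U x) = x"
  using A_U[of x 1] by simp

text \<open>Purity enters here: the projections of \<open>p\<close> onto the decreasing ranges of
  the powers of \<open>U\<close> converge to a vector in all of these ranges, hence to 0.\<close>

lemma A_pow_tendsto_0:
  assumes p: "p \<in> R"
  shows "(\<lambda>m. (A ^^ m) p) \<longlonglongrightarrow> 0"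
proof -
  \<comment> \<open>\<open>q m\<close> is the projection of \<open>p\<close> onto the range of \<open>U ^^ m\<close>.\<close>
  define q where "q m = (U ^^ m) ((A ^^ m) p)" for m
  define a where "a m = (norm (q m))\<^sup>2" for m
  have norm_q: "norm (q m) = norm ((A ^^ m) p)" for m
    by (simp add: q_def norm_U A_mem p)
  have "decseq a"
    by (rule decseq_SucI) (simp add: a_def norm_q power_mono norm_A_le A_mem p)
  then obtain L where "a \<longlonglongrightarrow> L"
    by (rule decseq_convergent[of a 0]) (auto simp: a_def)
  then have Cauchy_a: "Cauchy a" by (rule LIMSEQ_imp_Cauchy)
  \<comment> \<open>The projections are nested, so \<open>inner (q n) (q m)\<close> is the squared
    norm of \<open>q n\<close>; the convergent sequence \<open>a\<close> then controls all
    distances.\<close>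
  have q_dist: "(norm (q m - q n))\<^sup>2 = a m - a n" if le: "m \<le> n" for m n
  proof -
    obtain l where l: "n = m + l" using le_Suc_ex[OF le] ..
    have "(U ^^ n) x = (U ^^ m) ((U ^^ l) x)" for x by (simp add: l funpow_add)
    then have "cinner (q n) (q m) = cinner ((U ^^ l) ((A ^^ n) p)) ((A ^^ m) p)"
      by (simp add: q_def cinner_U U_mem A_mem p)
    also have "\<dots> = cinner ((A ^^ n) p) ((A ^^ l) ((A ^^ m) p))"
      by (rule adjoint_A) (simp_all add: A_mem p)
    also have "(A ^^ l) ((A ^^ m) p) = (A ^^ n) p"
      by (simp add: l add.commute[of m] funpow_add)
    finally have "inner (q n) (q m) = a n"
      by (simp add: inner_eq_Re_cinner cinner_self a_def norm_q)
    then show ?thesis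
      by (simp add: power2_norm_eq_inner a_def inner_diff inner_commute)
  qed
  have "Cauchy q"
  proof (rule metric_CauchyI)
    fix e :: real assume e: "0 < e"
    then obtain M where M: "dist (a m) (a n) < e\<^sup>2" if "m \<ge> M" "n \<ge> M" for m n
      using metric_CauchyD[OF Cauchy_a, of "e\<^sup>2"] by auto
    have le: "dist (q m) (q n) < e" if mn: "m \<ge> M" "n \<ge> M" "m \<le> n" for m n
    proof (rule power2_less_imp_less)
      have "a m - a n < e\<^sup>2" using M[OF mn(1,2)] abs_ge_self order_le_less_trans
        unfolding dist_real_def by blast
      then show "(dist (q m) (q n))\<^sup>2 < e\<^sup>2" by (simp add: dist_norm q_dist[OF mn(3)])
    qed (use e in simp)
    have "dist (q m) (q n) < e" if mn: "m \<ge> M" "n \<ge> M" for m n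
      using le[OF mn] le[OF mn(2,1)] by (cases "m \<le> n") (simp_all add: dist_commute)
    then show "\<exists>M. \<forall>m\<ge>M. \<forall>n\<ge>M. dist (q m) (q n) < e" by blast
  qed
  then obtain z where z: "q \<longlonglongrightarrow> z" using Cauchy_convergent_iff convergent_def by blast
  \<comment> \<open>From index \<open>k\<close> on, the sequence lies in the closed range of
    \<open>U ^^ k\<close>.\<close>
  have "z \<in> (U ^^ k) ` R" for k
  proof (rule closed_sequentially)
    show "closed ((U ^^ k) ` R)"
      by (rule closed_isometric_image[OF U_lin _ R]) (simp add: isometric_on_def norm_U)
    show "(\<lambda>m. q (m + k)) \<longlonglongrightarrow> z" using z by (rule LIMSEQ_ignore_initial_segment)
    show "q (m + k) \<in> (U ^^ k) ` R" for m
      unfolding q_def add.commute[of m] by (simp add: funpow_add[of _ _ U] U_mem A_mem p)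
  qed
  then have "z = 0" using pure by blast
  then show ?thesis using z tendsto_norm_zero_iff[of q] tendsto_norm_zero_iff[of "\<lambda>m. (A ^^ m) p"]
    by (simp add: norm_q)
qed

lemma U_weak_null:
  assumes "x \<in> R" "p \<in> R"
  shows "(\<lambda>m. cinner ((U ^^ m) x) p) \<longlonglongrightarrow> 0"
  using cinner.tendsto_right_zero[OF A_pow_tendsto_0[OF assms(2)], of x]
  by (simp add: adjoint_A assms)

section \<open>The unitary extension\<close>

text \<open>Scalar coordinates for \<open>R\<close>: Parseval's identity makes them an isometric
  embedding into \<open>ell2\<close>, with no need for orthonormality.\<close>

definition frame :: "nat \<Rightarrow> 'a" where
  "frame = (SOME f. \<forall>x\<in>R. (\<lambda>n. (cmod (cinner x (f n)))\<^sup>2) sums (norm x)\<^sup>2)"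

lemma frame: "x \<in> R \<Longrightarrow> (\<lambda>n. (cmod (cinner x (frame n)))\<^sup>2) sums (norm x)\<^sup>2"
  using someI_ex[OF parseval_frame_exists[of R]] separable
  by (simp add: frame_def separable_hilbert_def)

text \<open>On \<open>R\<close> this is the orthogonal projection onto the complement of the range
  of \<open>U\<close>, the wandering subspace.\<close>

definition defect :: "'a \<Rightarrow> 'a" where "defect x = x - U (A x)"

lemma defect_lin: "clinear_betw R R defect"
  unfolding clinear_betw_def defect_def
  by (auto simp: clinear_betw_add[OF U_lin1] clinear_betw_add[OF A_lin1]
      clinear_betw_scaleC[OF U_lin1] clinear_betw_scaleC[OF A_lin1]
      scaleC.diff_right A_mem1 U_mem1 csubspace_diff[OF R(1)])

lemmas defect_mem = clinear_betw_mem[OF defect_lin]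

text \<open>Pythagoras: \<open>U (A x)\<close> is the projection of \<open>x\<close> onto the range
  of \<open>U\<close> and has the norm of \<open>A x\<close>. Applied along the powers of
  \<open>A\<close>, the formula telescopes.\<close>

lemma norm_defect: "x \<in> R \<Longrightarrow> (norm (defect x))\<^sup>2 = (norm x)\<^sup>2 - (norm (A x))\<^sup>2"
proof -
  assume x: "x \<in> R"
  have "inner (U (A x)) x = (norm (A x))\<^sup>2"
    using adjoint_A[OF A_mem1[OF x] x, of 1] by (simp add: inner_eq_Re_cinner cinner_self)
  moreover have "inner (U (A x)) (U (A x)) = (norm (A x))\<^sup>2"
    by (simp add: norm_U1 A_mem1 x flip: power2_norm_eq_inner)
  ultimately show ?thesis
    unfolding defect_def power2_norm_eq_inner by (simp add: inner_diff inner_commute)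
qed

text \<open>The Wold decomposition of \<open>R\<close> is the sum of the spaces \<open>U\<^sup>l W\<close> with \<open>W\<close> the range of
  \<^term>\<open>defect\<close>, and the minimal unitary extension of \<open>U\<close> is the bilateral shift on the
  \<open>W\<close>-valued sequences over the integers. The map \<open>lift k\<close> embeds \<open>R\<close> into that space as the
  image of \<open>R\<close> under the \<open>k\<close>-th power of the inverse shift, in coordinates.\<close>

definition coord :: "nat \<Rightarrow> 'a \<Rightarrow> int \<times> nat \<Rightarrow> complex" where
  "coord k x = (\<lambda>(m, j). if 0 \<le> m + int k then cinner (defect ((A ^^ nat (m + int k)) x)) (frame j) else 0)"

text \<open>Flattens pairs of an integer position and a frame index, since \<open>ell2\<close> is
  indexed by natural numbers.\<close>

definition decode :: "nat \<Rightarrow> int \<times> nat" where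
  "decode n = map_prod int_decode id (prod_decode n)"

definition lift :: "nat \<Rightarrow> 'a \<Rightarrow> ell2" where
  "lift k x = Abs_ell2 (\<lambda>n. coord k x (decode n))"

text \<open>For each position the sum over the frame is the squared norm of a defect. Over the
  positions these telescope to the squared norm of \<open>x\<close>, as the powers of
  \<open>A\<close> tend to 0 at \<open>x\<close>.\<close>

lemma coord_has_sum:
  assumes x: "x \<in> R"
  shows "((\<lambda>i. (cmod (coord k x i))\<^sup>2) has_sum (norm x)\<^sup>2) UNIV"
proof -
  define t where "t l = (norm ((A ^^ l) x))\<^sup>2 - (norm ((A ^^ Suc l) x))\<^sup>2" for l
  define s where "s m = (if 0 \<le> m + int k then t (nat (m + int k)) else 0)" for m
  have t: "(norm (defect ((A ^^ l) x)))\<^sup>2 = t l" for l by (simp add: t_def norm_defect A_mem x)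
  have "t sums ((norm ((A ^^ 0) x))\<^sup>2 - 0)"
    unfolding t_def
    by (rule telescope_sums') (use tendsto_power[OF tendsto_norm_zero[OF A_pow_tendsto_0[OF x]], of 2] in simp)
  then have "(t has_sum (norm x)\<^sup>2) UNIV"
    by (intro sums_nonneg_imp_has_sum) (auto simp flip: t)
  \<comment> \<open>Position \<open>m\<close> carries the defect with exponent
    \<open>l = m + k\<close>; positions below \<open>- k\<close> hold zero.\<close>
  also have "?this \<longleftrightarrow> (s has_sum (norm x)\<^sup>2) {- int k..}"
    by (rule has_sum_reindex_bij_witness[where j = "\<lambda>l. int l - int k" and i = "\<lambda>m. nat (m + int k)"])
      (auto simp: s_def)
  also have "\<dots> \<longleftrightarrow> (s has_sum (norm x)\<^sup>2) UNIV"
    by (rule has_sum_cong_neutral) (auto simp: s_def)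
  finally have s: "(s has_sum (norm x)\<^sup>2) UNIV" .
  have inner: "((\<lambda>j. (cmod (coord k x (m, j)))\<^sup>2) has_sum s m) UNIV" for m
  proof (cases "0 \<le> m + int k")
    case True
    have "(\<lambda>j. (cmod (coord k x (m, j)))\<^sup>2) sums s m"
      using frame[of "defect ((A ^^ nat (m + int k)) x)"] True
      by (simp add: coord_def s_def t defect_mem A_mem x)
    then show ?thesis by (rule sums_nonneg_imp_has_sum) simp
  qed (simp add: coord_def s_def)
  have "(\<lambda>i. (cmod (coord k x i))\<^sup>2) summable_on UNIV \<times> UNIV"
    by (rule summable_on_SigmaI[OF inner]) (use s in \<open>auto simp: summable_on_def\<close>)
  from has_sum_SigmaI[OF inner s this] show ?thesis by simp
qed

lemma bij_decode: "bij decode"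
proof -
  have "decode = map_prod int_decode id \<circ> prod_decode" by (simp add: decode_def fun_eq_iff)
  moreover have "bij (map_prod int_decode (id :: nat \<Rightarrow> nat))"
    using bij_betw_map_prod[OF bij_int_decode bij_id] by simp
  ultimately show ?thesis using bij_prod_decode by (metis bij_comp)
qed

lemma lift_sums:
  assumes "x \<in> R"
  shows "(\<lambda>n. (cmod (coord k x (decode n)))\<^sup>2) sums (norm x)\<^sup>2"
  using coord_has_sum[OF assms, of k]
    has_sum_reindex_bij_betw[OF bij_decode, of "\<lambda>i. (cmod (coord k x i))\<^sup>2"]
  by (intro has_sum_imp_sums) simp

lemma Rep_lift: "x \<in> R \<Longrightarrow> Rep_ell2 (lift k x) = (\<lambda>n. coord k x (decode n))"
  using sums_summable[OF lift_sums, of x k] by (simp add: lift_def Abs_ell2_inverse)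

lemma norm_lift:
  assumes "x \<in> R"
  shows "norm (lift k x) = norm x"
proof (rule power2_eq_imp_eq)
  show "(norm (lift k x))\<^sup>2 = (norm x)\<^sup>2"
    using sums_unique[OF lift_sums[OF assms, of k]] by (simp add: ell2_norm_square Rep_lift assms)
qed simp_all

lemma lift_lin: "clinear_betw R UNIV (lift k)"
proof -
  have "coord k (x + y) i = coord k x i + coord k y i" if "x \<in> R" "y \<in> R" for x y i
    using that by (cases i) (simp add: coord_def clinear_betw_add[OF A_lin] clinear_betw_add[OF defect_lin]
        A_mem cinner_add_left)
  moreover have "coord k (c *\<^sub>C x) i = c * coord k x i" if "x \<in> R" for c x i
    using that by (cases i) (simp add: coord_def clinear_betw_scaleC[OF A_lin]
        clinear_betw_scaleC[OF defect_lin] A_mem cinner_scaleC_left)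
  ultimately show ?thesis
    by (simp add: clinear_betw_def Rep_ell2_inject[symmetric] Rep_lift csubspace_add[OF R(1)]
        csubspace_scaleC[OF R(1)] plus_ell2.rep_eq scaleC_ell2.rep_eq)
qed

lemma lift_isometric: "isometric_on R (lift k)"
  by (simp add: isometric_on_def norm_lift)

lemma cinner_lift: "x \<in> R \<Longrightarrow> y \<in> R \<Longrightarrow> cinner (lift k x) (lift k y) = cinner x y"
  by (rule clinear_isometric_cinner[OF lift_lin R(1) lift_isometric])

text \<open>\<open>A\<close> undoes \<open>U\<close>, so the raised exponent cancels the extra
  \<open>U\<close>. Consequently the ranges of \<open>lift k\<close> increase with
  \<open>k\<close>.\<close>

lemma lift_Suc_U:
  assumes x: "x \<in> R"
  shows "lift (Suc k) (U x) = lift k x"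
proof -
  have "coord (Suc k) (U x) (m, j) = coord k x (m, j)" for m j
  proof (cases "0 \<le> m + int k")
    case True
    have "m + int (Suc k) = 1 + (m + int k)" by simp
    then have "nat (m + int (Suc k)) = Suc (nat (m + int k))"
      by (simp only: Suc_nat_eq_nat_zadd1[OF True])
    then have "(A ^^ nat (m + int (Suc k))) (U x) = (A ^^ nat (m + int k)) x"
      by (simp only: funpow_Suc_right o_apply A_U1[OF x])
    then show ?thesis using True by (simp add: coord_def)
  next
    \<comment> \<open>The one position gained, \<open>m = - Suc k\<close>, carries
      \<open>defect (U x)\<close>, which is 0; further left both sides are zero by default.\<close>
    case False
    then show ?thesis
      by (cases "m + int (Suc k) = 0") (auto simp: coord_def defect_def A_U1 x)
  qed
  then have "coord (Suc k) (U x) = coord k x" by (simp add: fun_eq_iff)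
  then show ?thesis by (simp only: lift_def)
qed

lemma lift_add_U: "x \<in> R \<Longrightarrow> lift (k + m) ((U ^^ m) x) = lift k x"
  by (induction m) (simp_all add: lift_Suc_U U_mem)

section \<open>The extension space as the closure of a union of copies\<close>

definition D :: "ell2 set" where "D = (\<Union>k. lift k ` R)"

definition N :: "ell2 set" where "N = closure D"

lemma lift_D: "x \<in> R \<Longrightarrow> lift k x \<in> D"
  by (auto simp: D_def)

lemma D_N: "D \<subseteq> N"
  by (simp add: N_def closure_subset)

lemma lift_N: "x \<in> R \<Longrightarrow> lift k x \<in> N"
  using lift_D D_N by blast

lemma D_E:
  assumes "y \<in> D"
  obtains k x where "x \<in> R" "y = lift k x"
  using assms by (auto simp: D_def)

text \<open>Since the ranges are nested, any two vectors have representatives at the common level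
  \<open>k + l\<close>.\<close>

lemma D_E2:
  assumes "y \<in> D" "z \<in> D"
  obtains k x x' where "x \<in> R" "x' \<in> R" "y = lift k x" "z = lift k x'"
proof -
  obtain k x l x' where "x \<in> R" "y = lift k x" "x' \<in> R" "z = lift l x'"
    using assms by (metis D_E)
  then have "y = lift (k + l) ((U ^^ l) x)" "z = lift (k + l) ((U ^^ k) x')"
    using lift_add_U[of x k l] lift_add_U[of x' l k] by (simp_all add: add.commute[of l k])
  then show ?thesis using that U_mem \<open>x \<in> R\<close> \<open>x' \<in> R\<close> by blast
qed

lemma csubspace_D: "csubspace D"
  unfolding csubspace_def
proof (intro conjI ballI allI)
  show "0 \<in> D"
    using lift_D[OF csubspace_zero[OF R(1)], of 0] clinear_betw_zero[OF lift_lin R(1)] by simp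
next
  fix y z assume "y \<in> D" "z \<in> D"
  then obtain k x x' where "x \<in> R" "x' \<in> R" "y = lift k x" "z = lift k x'" by (rule D_E2)
  then show "y + z \<in> D"
    using lift_D[OF csubspace_add[OF R(1)], of x x' k] by (simp add: clinear_betw_add[OF lift_lin])
next
  fix c y assume "y \<in> D"
  then obtain k x where "x \<in> R" "y = lift k x" by (rule D_E)
  then show "c *\<^sub>C y \<in> D"
    using lift_D[OF csubspace_scaleC[OF R(1)], of x k c] by (simp add: clinear_betw_scaleC[OF lift_lin])
qed

lemma N: "csubspace N" "closed N"
  by (simp_all add: N_def csubspace_closure csubspace_D)

lemma lift_continuous: "continuous_on R (lift k)"
  using clinear_bounded_uniformly_continuous_on[OF lift_lin R(1), of k 1]
  by (simp add: norm_lift uniformly_continuous_imp_continuous)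

text \<open>The lifts, at all levels, of a countable dense subset of \<open>R\<close> are
  dense.\<close>

lemma separable_N: "separable_hilbert N"
proof -
  obtain S where S: "countable S" "S \<subseteq> R" "top_of_set R closure_of S = R"
    using separable by (auto simp: separable_hilbert_def separable_space_def)
  have RS: "R \<subseteq> closure S" using S(2,3) by (auto simp: closure_of_subtopology inf.absorb2)
  then have R_eq: "closure S = R" using closure_minimal[OF S(2) R(2)] by blast
  define C where "C = (\<Union>k. lift k ` S)"
  have C: "countable C" "C \<subseteq> D" using S(1,2) by (auto simp: C_def D_def)
  have "lift k ` closure S \<subseteq> closure C" for k
    by (rule image_closure_subset) (auto simp: R_eq lift_continuous C_def intro: subsetD[OF closure_subset])
  then have "D \<subseteq> closure C" by (auto simp: D_def R_eq)
  then have "N \<subseteq> closure C" unfolding N_def by (simp add: closure_minimal)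
  moreover have "closure C \<subseteq> N" unfolding N_def by (rule closure_mono[OF C(2)])
  ultimately have "top_of_set N closure_of C = N"
    using C(2) D_N by (simp add: closure_of_subtopology inf.absorb2 subset_trans)
  then show ?thesis
    using C D_N N by (auto simp: separable_hilbert_def separable_space_def)
qed

lemma N_eqI:
  fixes f g :: "ell2 \<Rightarrow> 'b :: real_normed_vector"
  assumes "continuous_on N f" "continuous_on N g"
    and "\<And>k x. x \<in> R \<Longrightarrow> f (lift k x) = g (lift k x)" "y \<in> N"
  shows "f y = g y"
proof (rule continuous_on_closure_eqI[of D f g])
  show "f y = g y" if "y \<in> D" for y using that assms(3) by (metis D_E)
qed (use assms in \<open>simp_all add: N_def\<close>)

section \<open>Extending operators that commute with the isometry\<close>

definition intertwiner :: "('a \<Rightarrow> 'a) \<Rightarrow> bool" where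
  "intertwiner S \<longleftrightarrow> bounded_operator R S \<and> (\<forall>x\<in>R. U (S x) = S (U x))"

text \<open>Continuity and the values on lifts already determine the function on \<open>N\<close>;
  for intertwiners, linearity and boundedness follow by density.\<close>

definition extension :: "('a \<Rightarrow> 'a) \<Rightarrow> ell2 \<Rightarrow> ell2" where
  "extension S = (SOME g. continuous_on N g \<and> (\<forall>k. \<forall>x\<in>R. g (lift k x) = lift k (S x)))"

lemma intertwiner_mem: "intertwiner S \<Longrightarrow> x \<in> R \<Longrightarrow> S x \<in> R"
  by (auto simp: intertwiner_def bounded_operator_def clinear_betw_def)

lemma intertwiner_U:
  assumes "intertwiner S" "x \<in> R"
  shows "S ((U ^^ m) x) = (U ^^ m) (S x)"
proof (induction m)
  case (Suc m)
  have "S (U ((U ^^ m) x)) = U (S ((U ^^ m) x))"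
    using assms U_mem by (simp add: intertwiner_def)
  then show ?case by (simp add: Suc)
qed simp

text \<open>Commuting with powers of \<open>U\<close> makes the prescription independent of the
  level: two representatives are compared at level \<open>k + l\<close>. The bound of
  \<open>S\<close> is a Lipschitz constant on \<open>D\<close>, so the map extends to the
  closure.\<close>

lemma extension_exists:
  assumes S: "intertwiner S"
  shows "\<exists>g. continuous_on N g \<and> (\<forall>k. \<forall>x\<in>R. g (lift k x) = lift k (S x))"
proof -
  define g where "g y = (SOME z. \<exists>k x. x \<in> R \<and> y = lift k x \<and> z = lift k (S x))" for y
  have g: "g (lift k x) = lift k (S x)" if x: "x \<in> R" for k x
    unfolding g_def
  proof (rule some_equality)
    fix z assume "\<exists>l x'. x' \<in> R \<and> lift k x = lift l x' \<and> z = lift l (S x')"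
    then obtain l x' where x': "x' \<in> R" "lift k x = lift l x'" "z = lift l (S x')" by blast
    have "lift (k + l) ((U ^^ l) x) = lift (k + l) ((U ^^ k) x')"
      using lift_add_U[OF x, of k l] lift_add_U[OF x'(1), of l k] x'(2) by (simp add: add.commute)
    then have "lift (k + l) ((U ^^ l) x - (U ^^ k) x') = 0"
      by (simp add: clinear_betw_diff[OF lift_lin R(1)] U_mem x x'(1))
    then have "(U ^^ l) x = (U ^^ k) x'"
      using norm_lift[of "(U ^^ l) x - (U ^^ k) x'" "k + l"] by (simp add: csubspace_diff[OF R(1)] U_mem x x'(1))
    then have "(U ^^ l) (S x) = (U ^^ k) (S x')"
      using intertwiner_U[OF S x, of l] intertwiner_U[OF S x'(1), of k] by simp
    then show "z = lift k (S x)"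
      using lift_add_U[OF intertwiner_mem[OF S x], of k l]
        lift_add_U[OF intertwiner_mem[OF S x'(1)], of l k] x'(3) by (simp add: add.commute)
  qed (use x in blast)
  obtain C where C: "C \<ge> 0" "\<And>x. x \<in> R \<Longrightarrow> norm (S x) \<le> C * norm x"
    using S bounded_operatorE by (metis intertwiner_def)
  have "C-lipschitz_on D g"
  proof (rule lipschitz_onI)
    fix y z assume "y \<in> D" "z \<in> D"
    then obtain k x x' where x: "x \<in> R" "x' \<in> R" "y = lift k x" "z = lift k x'" by (rule D_E2)
    have lin: "clinear_betw R R S" using S by (simp add: intertwiner_def bounded_operator_def)
    have dist: "dist (lift k u) (lift k v) = norm (u - v)" if "u \<in> R" "v \<in> R" for u v
      using norm_lift[OF csubspace_diff[OF R(1) that], of k]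
      by (simp add: dist_norm clinear_betw_diff[OF lift_lin R(1)] that)
    show "dist (g y) (g z) \<le> C * dist y z"
      using C(2)[OF csubspace_diff[OF R(1) x(1,2)]]
      by (simp add: x g dist intertwiner_mem[OF S] clinear_betw_diff[OF lin R(1)])
  qed (rule C(1))
  then obtain h where "uniformly_continuous_on N h" "\<And>y. y \<in> D \<Longrightarrow> g y = h y"
    unfolding N_def using uniformly_continuous_on_extension_on_closure lipschitz_on_uniformly_continuous
    by metis
  then show ?thesis
    using g lift_D by (intro exI[of _ h]) (auto simp: uniformly_continuous_imp_continuous simp flip: g)
qed

lemma
  assumes "intertwiner S"
  shows extension_continuous: "continuous_on N (extension S)"
    and extension_lift: "x \<in> R \<Longrightarrow> extension S (lift k x) = lift k (S x)"
  using someI_ex[OF extension_exists[OF assms]] by (auto simp: extension_def)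

lemma extension_mem:
  assumes "intertwiner S" "y \<in> N"
  shows "extension S y \<in> N"
proof -
  have "extension S ` D \<subseteq> N"
    using lift_N intertwiner_mem[OF assms(1)] extension_lift[OF assms(1)] by (auto elim!: D_E)
  then have "extension S ` closure D \<subseteq> N"
    using extension_continuous[OF assms(1)] N(2) by (intro image_closure_subset) (simp_all add: N_def)
  then show ?thesis using assms(2) by (auto simp: N_def)
qed

lemma extension_lin:
  assumes S: "intertwiner S"
  shows "clinear_betw N N (extension S)"
proof -
  let ?T = "extension S"
  have lin: "clinear_betw R R S" using S by (simp add: intertwiner_def bounded_operator_def)
  note cont = extension_continuous[OF S]
  have "?T (y + z) = ?T y + ?T z" if "y \<in> N" "z \<in> N" for y z
  proof -
    \<comment> \<open>Density is used in both arguments at once: the two sides are continuous on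
      \<open>N \<times> N\<close> and agree on \<open>D \<times> D\<close>, where a common level
      exists.\<close>
    have "(\<lambda>p. ?T (fst p + snd p)) (y, z) = (\<lambda>p. ?T (fst p) + ?T (snd p)) (y, z)"
    proof (rule continuous_on_closure_eqI[of "D \<times> D"])
      have NN: "closure (D \<times> D) = N \<times> N" by (simp add: closure_Times N_def)
      show "continuous_on (closure (D \<times> D)) (\<lambda>p. ?T (fst p + snd p))"
        unfolding NN by (rule continuous_on_compose2[OF cont])
          (auto intro!: continuous_intros csubspace_add[OF N(1)])
      show "continuous_on (closure (D \<times> D)) (\<lambda>p. ?T (fst p) + ?T (snd p))"
        unfolding NN by (intro continuous_on_add continuous_on_compose2[OF cont] continuous_intros) auto
      show "(y, z) \<in> closure (D \<times> D)" using that by (simp add: NN)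
      fix p assume "p \<in> D \<times> D"
      then obtain y z where p: "p = (y, z)" "y \<in> D" "z \<in> D" by auto
      obtain k x x' where x: "x \<in> R" "x' \<in> R" "y = lift k x" "z = lift k x'"
        using D_E2[OF p(2,3)] .
      have "?T (lift k x + lift k x') = lift k (S (x + x'))"
        using extension_lift[OF S csubspace_add[OF R(1) x(1,2)], of k]
        by (simp add: clinear_betw_add[OF lift_lin] x)
      then show "?T (fst p + snd p) = ?T (fst p) + ?T (snd p)"
        by (simp add: p(1) x extension_lift[OF S] clinear_betw_add[OF lin]
            clinear_betw_add[OF lift_lin] intertwiner_mem[OF S])
    qed
    then show ?thesis by simp
  qed
  moreover have "?T (c *\<^sub>C y) = c *\<^sub>C ?T y" if "y \<in> N" for c y
  proof (rule N_eqI[OF _ _ _ that])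
    show "continuous_on N (\<lambda>y. ?T (c *\<^sub>C y))"
      by (rule continuous_on_compose2[OF cont])
        (auto intro!: csubspace_scaleC[OF N(1)] scaleC.continuous_on continuous_intros)
    show "continuous_on N (\<lambda>y. c *\<^sub>C ?T y)"
      by (intro scaleC.continuous_on cont continuous_intros)
    fix k x assume x: "x \<in> R"
    have "?T (c *\<^sub>C lift k x) = lift k (S (c *\<^sub>C x))"
      using extension_lift[OF S csubspace_scaleC[OF R(1) x], of k c]
      by (simp add: clinear_betw_scaleC[OF lift_lin] x)
    then show "?T (c *\<^sub>C lift k x) = c *\<^sub>C ?T (lift k x)"
      by (simp add: x extension_lift[OF S] clinear_betw_scaleC[OF lin]
          clinear_betw_scaleC[OF lift_lin] intertwiner_mem[OF S])
  qed
  ultimately show ?thesis using extension_mem[OF S] by (auto simp: clinear_betw_def)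
qed

text \<open>The constant is preserved, so the uniform bound of the module action passes to
  \<open>N\<close>.\<close>

lemma norm_extension_le:
  assumes S: "intertwiner S" and C: "\<And>x. x \<in> R \<Longrightarrow> norm (S x) \<le> C * norm x" and y: "y \<in> N"
  shows "norm (extension S y) \<le> C * norm y"
proof -
  have "norm (extension S y) - C * norm y \<le> 0"
  proof (rule continuous_le_on_closure[of D])
    show "continuous_on (closure D) (\<lambda>y. norm (extension S y) - C * norm y)"
      using extension_continuous[OF S] by (intro continuous_intros) (simp_all add: N_def)
    show "norm (extension S y) - C * norm y \<le> 0" if "y \<in> D" for y
      using that by (rule D_E) (simp add: extension_lift[OF S] norm_lift intertwiner_mem[OF S] C)
  qed (use y in \<open>simp add: N_def\<close>)
  then show ?thesis by simp
qed

lemma extension_bounded: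
  assumes S: "intertwiner S"
  shows "bounded_operator N (extension S)"
proof -
  obtain C where "\<And>x. x \<in> R \<Longrightarrow> norm (S x) \<le> C * norm x"
    using S bounded_operatorE by (metis intertwiner_def)
  then show ?thesis
    using extension_lin[OF S] norm_extension_le[OF S] unfolding bounded_operator_def by blast
qed

text \<open>The witness \<open>g\<close> shows that the choice in \<open>extension S\<close>
  succeeds. Sums, multiples and products in the action can thus be handled through explicit
  candidates.\<close>

lemma extension_eqI:
  assumes "continuous_on N g" "\<And>k x. x \<in> R \<Longrightarrow> g (lift k x) = lift k (S x)" "y \<in> N"
  shows "extension S y = g y"
proof -
  have ext: "continuous_on N (extension S) \<and> (\<forall>k. \<forall>x\<in>R. extension S (lift k x) = lift k (S x))"
    unfolding extension_def by (rule someI[of _ g]) (use assms in blast)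
  show ?thesis
    by (rule N_eqI[OF _ assms(1) _ assms(3)]) (simp_all add: ext assms(2))
qed

section \<open>Normality of the extended operators\<close>

text \<open>By the intertwining relation, the orthogonal projection of \<open>T\<^sup>* (lift k x)\<close> onto the range
  of \<open>lift (k + m)\<close> is \<open>lift (k + m) (S\<^sup>* (U\<^sup>m x))\<close>, and these ranges exhaust \<open>N\<close>.\<close>

lemma adjoint_extension_tendsto:
  assumes S: "intertwiner S" and x: "x \<in> R"
  shows "(\<lambda>m. norm (adjoint_on R S ((U ^^ m) x))) \<longlonglongrightarrow> norm (adjoint_on N (extension S) (lift k x))"
proof -
  define z where "z = adjoint_on N (extension S) (lift k x)"
  define a where "a m = adjoint_on R S ((U ^^ m) x)" for m
  have bS: "bounded_operator R S" using S by (simp add: intertwiner_def)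
  have zN: "z \<in> N" unfolding z_def by (rule adjoint_on_mem[OF N extension_bounded[OF S] lift_N[OF x]])
  have aR: "a m \<in> R" for m unfolding a_def by (rule adjoint_on_mem[OF R bS U_mem[OF x]])
  have proj: "cinner (lift (k + m) r) z = cinner (lift (k + m) r) (lift (k + m) (a m))" if r: "r \<in> R" for m r
  proof -
    have "cinner (lift (k + m) r) z = cinner (lift (k + m) (S r)) (lift (k + m) ((U ^^ m) x))"
      using cinner_adjoint_on[OF N extension_bounded[OF S] lift_N[OF x, of k] lift_N[OF r, of "k + m"]]
      by (simp add: z_def extension_lift[OF S] r lift_add_U x)
    also have "\<dots> = cinner r (a m)"
      by (simp add: cinner_lift intertwiner_mem[OF S] r U_mem x a_def cinner_adjoint_on[OF R bS])
    finally show ?thesis by (simp add: cinner_lift r aR)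
  qed
  have "(\<lambda>m. lift (k + m) (a m)) \<longlonglongrightarrow> z"
  proof (rule metric_LIMSEQ_I)
    fix e :: real assume "0 < e"
    then obtain d where d: "d \<in> D" "dist d z < e"
      using zN unfolding N_def closure_approachable by blast
    obtain l r where r: "r \<in> R" "d = lift l r" using D_E[OF d(1)] .
    have "dist (lift (k + m) (a m)) z < e" if m: "m \<ge> l" for m
    proof -
      \<comment> \<open>Rewrites \<open>d\<close> at level \<open>k + m\<close>, which lies above
        its own level \<open>l\<close>.\<close>
      define r' where "r' = (U ^^ (k + m - l)) r"
      have r': "r' \<in> R" "d = lift (k + m) r'"
        using lift_add_U[OF r(1), of l "k + m - l"] m r by (simp_all add: r'_def U_mem)
      let ?w = "lift (k + m) (a m)"
      \<comment> \<open>\<open>?w\<close> is the projection of \<open>z\<close> onto a space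
        containing \<open>d\<close>, hence at least as close to \<open>z\<close> as \<open>d\<close>
        is.\<close>
      have "inner ?w z = inner ?w ?w" "inner d z = inner d ?w"
        by (simp_all add: inner_eq_Re_cinner proj aR r')
      then have "(norm (d - z))\<^sup>2 = (norm (?w - z))\<^sup>2 + (norm (d - ?w))\<^sup>2"
        by (simp add: power2_norm_eq_inner inner_diff inner_commute)
      then have "(norm (?w - z))\<^sup>2 \<le> (norm (d - z))\<^sup>2" by simp
      then have "norm (?w - z) \<le> norm (d - z)" by (rule power2_le_imp_le) simp
      then show ?thesis using d(2) by (simp add: dist_norm)
    qed
    then show "\<exists>M. \<forall>m\<ge>M. dist (lift (k + m) (a m)) z < e" by blast
  qed
  from tendsto_norm[OF this] show ?thesis by (simp add: norm_lift aR flip: a_def z_def)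
qed

text \<open>Compactness enters here: the quadratic form of the self-commutator at
  \<open>U\<^sup>m x\<close> tends to 0 by weak nullity. It is the difference of the squared norms
  of \<open>S\<close> and its adjoint there, and the former stays constant because \<open>S\<close>
  commutes with the isometry.\<close>

lemma norm_adjoint_intertwiner_tendsto:
  assumes S: "intertwiner S"
    and K: "compact_operator R (\<lambda>x. adjoint_on R S (S x) - S (adjoint_on R S x))"
    and x: "x \<in> R" "norm x \<le> 1"
  shows "(\<lambda>m. norm (adjoint_on R S ((U ^^ m) x))) \<longlonglongrightarrow> norm (S x)"
proof -
  have bS: "bounded_operator R S" using S by (simp add: intertwiner_def)
  note mem = adjoint_on_mem[OF R bS] and adj = cinner_adjoint_on[OF R bS]
  define u where "u m = (U ^^ m) x" for m
  have u: "u m \<in> R" "norm (u m) \<le> 1" "norm (S (u m)) = norm (S x)" for m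
    using x by (simp_all add: u_def U_mem norm_U intertwiner_U[OF S] intertwiner_mem[OF S])
  have "Re (cinner (adjoint_on R S (S v) - S (adjoint_on R S v)) v) = (norm (S v))\<^sup>2 - (norm (adjoint_on R S v))\<^sup>2"
    if v: "v \<in> R" for v
  proof -
    have "cinner (adjoint_on R S (S v)) v = cnj (cinner v (adjoint_on R S (S v)))" by (rule cinner_commute)
    also have "\<dots> = cnj (cinner (S v) (S v))" using adj[OF intertwiner_mem[OF S v] v] by simp
    finally show ?thesis
      using adj[OF v mem[OF v]] by (simp add: cinner.diff_left cinner_self)
  qed
  then have "(\<lambda>m. (norm (S x))\<^sup>2 - (norm (adjoint_on R S (u m)))\<^sup>2) \<longlonglongrightarrow> 0"
    using tendsto_Re[OF compact_operator_weak_null[OF R K u(1,2)]] U_weak_null[OF x(1)]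
    by (simp add: u(1,3)) (simp add: u_def)
  from tendsto_diff[OF tendsto_const[of "(norm (S x))\<^sup>2"] this]
  have "(\<lambda>m. (norm (adjoint_on R S (u m)))\<^sup>2) \<longlonglongrightarrow> (norm (S x))\<^sup>2" by simp
  from tendsto_real_sqrt[OF this] show ?thesis by (simp add: u_def)
qed

text \<open>The same sequence has both norms as its limit; this gives equality on lifts, and density
  does the rest.\<close>

lemma norm_adjoint_extension:
  assumes S: "intertwiner S"
    and K: "compact_operator R (\<lambda>x. adjoint_on R S (S x) - S (adjoint_on R S x))"
    and y: "y \<in> N"
  shows "norm (adjoint_on N (extension S) y) = norm (extension S y)"
proof (rule N_eqI[OF _ _ _ y])
  let ?T = "extension S" and ?A = "adjoint_on N (extension S)"
  obtain C where C: "\<And>y. y \<in> N \<Longrightarrow> norm (?T y) \<le> C * norm y"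
    using bounded_operatorE[OF extension_bounded[OF S]] by metis
  note A = bounded_operator_adjoint_on[OF N extension_bounded[OF S] C]
  have A_lin: "clinear_betw N N ?A" using A(1) by (simp add: bounded_operator_def)
  show "continuous_on N (\<lambda>y. norm (?T y))"
    by (intro continuous_on_norm extension_continuous[OF S])
  show "continuous_on N (\<lambda>y. norm (?A y))"
    by (intro continuous_on_norm uniformly_continuous_imp_continuous
        clinear_bounded_uniformly_continuous_on[OF A_lin N(1) A(2)])
  fix k x assume x: "x \<in> R"
  \<comment> \<open>Scales \<open>x\<close> into the unit ball; adding 1 covers
    \<open>x = 0\<close>, and positivity of \<open>c\<close> lets the factor be cancelled at the
    end.\<close>
  define c where "c = inverse (norm x + 1)"
  have c: "0 < c" "c * norm x \<le> 1"
    using norm_ge_zero[of x] by (simp_all add: c_def divide_simps add_nonneg_pos)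
  define x' where "x' = complex_of_real c *\<^sub>C x"
  have x': "x' \<in> R" "norm x' \<le> 1"
    using c by (simp_all add: x'_def x csubspace_scaleC[OF R(1)] norm_scaleC)
  have "norm (?A (lift k x')) = norm (S x')"
    by (rule LIMSEQ_unique[OF adjoint_extension_tendsto[OF S x'(1)]
          norm_adjoint_intertwiner_tendsto[OF S K x']])
  also have "\<dots> = norm (?T (lift k x'))"
    by (simp add: extension_lift[OF S] x' norm_lift intertwiner_mem[OF S])
  finally have "norm (?A (lift k x')) = norm (?T (lift k x'))" .
  moreover have "lift k x' = complex_of_real c *\<^sub>C lift k x"
    by (simp add: x'_def clinear_betw_scaleC[OF lift_lin] x)
  ultimately show "norm (?A (lift k x)) = norm (?T (lift k x))"
    using c(1) by (simp add: clinear_betw_scaleC[OF A_lin] clinear_betw_scaleC[OF extension_lin[OF S]]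
        lift_N x norm_scaleC)
qed

text \<open>Equal norms of an operator and its adjoint polarize to equal inner products, which is
  commutation with the adjoint.\<close>

lemma normal_extension:
  assumes S: "intertwiner S"
    and K: "compact_operator R (\<lambda>x. adjoint_on R S (S x) - S (adjoint_on R S x))"
  shows "normal_operator N (extension S)"
proof -
  let ?T = "extension S" and ?A = "adjoint_on N (extension S)"
  note bT = extension_bounded[OF S]
  note mem = adjoint_on_mem[OF N bT] and adj = cinner_adjoint_on[OF N bT]
  obtain C where C: "\<And>y. y \<in> N \<Longrightarrow> norm (?T y) \<le> C * norm y"
    using bounded_operatorE[OF bT] by metis
  have A_lin: "clinear_betw N N ?A"
    using bounded_operator_adjoint_on(1)[OF N bT C] by (simp add: bounded_operator_def)
  have "?A (?T y) = ?T (?A y)" if y: "y \<in> N" for y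
  proof (rule cinner_ext[OF N(1)])
    fix w assume w: "w \<in> N"
    have "cinner w (?A (?T y)) = cinner (?T w) (?T y)"
      by (simp add: adj extension_mem[OF S] y w)
    also have "\<dots> = cinner (?A w) (?A y)"
      by (rule cinner_clinear_cong[OF extension_lin[OF S] A_lin N(1) _ w y])
        (simp add: norm_adjoint_extension[OF S K])
    also have "\<dots> = cnj (cinner (?T (?A y)) w)"
      using adj[OF w mem[OF y]] cinner_commute[of "?A w" "?A y"] by simp
    also have "\<dots> = cinner w (?T (?A y))" by (rule cinner_commute[symmetric])
    finally show "cinner w (?A (?T y)) = cinner w (?T (?A y))" .
  qed (simp_all add: mem extension_mem[OF S] y)
  then show ?thesis using bT by (simp add: normal_operator_def)
qed

end

section \<open>Hilbert modules\<close>

text \<open>A coordinate is complex linear, hence holomorphic everywhere, and serves as its own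
  approximation.\<close>

lemma coordinate_in_domain_algebra: "coordinate \<Omega> i \<in> domain_algebra \<Omega>"
proof -
  have "holomorphic_several (\<lambda>z. z $ i) UNIV"
    unfolding holomorphic_several_def
    by (intro ballI exI[of _ "\<lambda>z. z $ i"])
      (auto intro: bounded_linear_imp_has_derivative bounded_linear_vec_nth)
  then have "\<exists>g V. open V \<and> closure \<Omega> \<subseteq> V \<and> holomorphic_several g V \<and>
      (\<forall>z\<in>closure \<Omega>. cmod (coordinate \<Omega> i z - g z) \<le> e)" if "0 < e" for e
    using that by (intro exI[of _ "\<lambda>z. z $ i"] exI[of _ UNIV]) (simp add: coordinate_def)
  moreover have "continuous_on (closure \<Omega>) (coordinate \<Omega> i)"
    unfolding coordinate_def by (simp cong: continuous_on_cong) (intro continuous_intros)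
  ultimately show ?thesis by (auto simp: domain_algebra_def coordinate_def)
qed

lemma hilbert_module_bounded_operator:
  assumes "hilbert_module \<Omega> H act" "f \<in> domain_algebra \<Omega>"
  shows "bounded_operator H (act f)"
  using assms unfolding hilbert_module_def bounded_operator_def by blast

lemma (in pure_isometry) intertwiner_act:
  assumes "hilbert_module \<Omega> R act" "module_map \<Omega> R act U" "f \<in> domain_algebra \<Omega>"
  shows "intertwiner (act f)"
  using assms hilbert_module_bounded_operator[OF assms(1,3)]
  by (simp add: intertwiner_def module_map_def)

text \<open>Every module law holds on lifts because it holds on \<open>R\<close>, and passes to
  \<open>N\<close> by continuity. The coordinate operators commute because the algebra does.\<close>

lemma (in pure_isometry) normal_module_extension:
  assumes ess: "essentially_normal_module \<Omega> R act" and U: "module_map \<Omega> R act U"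
  shows "normal_module \<Omega> N (\<lambda>f. extension (act f))"
proof -
  have mod: "hilbert_module \<Omega> R act" using ess by (simp add: essentially_normal_module_def)
  note act = intertwiner_act[OF mod U]
  note ext_lift = extension_lift[OF act] and ext_cont = extension_continuous[OF act]
  have act_mem: "act f x \<in> R" if "f \<in> domain_algebra \<Omega>" "x \<in> R" for f x
    using intertwiner_mem[OF act] that .
  have comp: "extension (act f) (extension (act g) y) = extension (act h) y"
    if fg: "f \<in> domain_algebra \<Omega>" "g \<in> domain_algebra \<Omega>" and y: "y \<in> N"
      and h: "\<And>x. x \<in> R \<Longrightarrow> act h x = act f (act g x)" for f g h y
  proof (rule extension_eqI[symmetric, OF _ _ y])
    show "continuous_on N (\<lambda>y. extension (act f) (extension (act g) y))"
      by (rule continuous_on_compose2[OF ext_cont[OF fg(1)] ext_cont[OF fg(2)]])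
        (auto intro: extension_mem[OF act[OF fg(2)]])
  qed (simp add: ext_lift fg act_mem h)
  have one: "extension (act (alg_one \<Omega>)) y = y" if "y \<in> N" for y
    using mod that by (intro extension_eqI) (auto simp: hilbert_module_def)
  have scale: "extension (act (alg_scale \<Omega> c f)) y = c *\<^sub>C extension (act f) y"
    if f: "f \<in> domain_algebra \<Omega>" and y: "y \<in> N" for c f y
  proof (rule extension_eqI[OF _ _ y])
    show "continuous_on N (\<lambda>y. c *\<^sub>C extension (act f) y)"
      by (intro scaleC.continuous_on ext_cont[OF f] continuous_on_const)
    show "c *\<^sub>C extension (act f) (lift k x) = lift k (act (alg_scale \<Omega> c f) x)" if "x \<in> R" for k x
      using mod f that by (simp add: hilbert_module_def ext_lift clinear_betw_scaleC[OF lift_lin] act_mem)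
  qed
  have add: "extension (act (alg_add \<Omega> f g)) y = extension (act f) y + extension (act g) y"
    if fg: "f \<in> domain_algebra \<Omega>" "g \<in> domain_algebra \<Omega>" and y: "y \<in> N" for f g y
  proof (rule extension_eqI[OF _ _ y])
    show "continuous_on N (\<lambda>y. extension (act f) y + extension (act g) y)"
      by (intro continuous_on_add ext_cont fg)
    show "extension (act f) (lift k x) + extension (act g) (lift k x) = lift k (act (alg_add \<Omega> f g) x)"
      if "x \<in> R" for k x
      using mod fg that by (simp add: hilbert_module_def ext_lift clinear_betw_add[OF lift_lin] act_mem)
  qed
  have mult: "extension (act (alg_mult \<Omega> f g)) y = extension (act f) (extension (act g) y)"
    if fg: "f \<in> domain_algebra \<Omega>" "g \<in> domain_algebra \<Omega>" and y: "y \<in> N" for f g y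
    using mod fg by (intro comp[OF fg y, symmetric]) (simp add: hilbert_module_def)
  obtain C where C: "\<And>f x. f \<in> domain_algebra \<Omega> \<Longrightarrow> x \<in> R \<Longrightarrow> norm (act f x) \<le> C * sup_norm \<Omega> f * norm x"
    using mod unfolding hilbert_module_def by blast
  have bound: "norm (extension (act f) y) \<le> C * sup_norm \<Omega> f * norm y"
    if "f \<in> domain_algebra \<Omega>" "y \<in> N" for f y
    using norm_extension_le[OF act[OF that(1)] C[OF that(1)] that(2)] .
  have "hilbert_module \<Omega> N (\<lambda>f. extension (act f))"
    unfolding hilbert_module_def
    using separable_N extension_lin[OF act] one scale add mult bound by blast
  \<comment> \<open>Essential normality with \<open>i = j\<close> supplies the compact
    self-commutator.\<close>
  moreover have "normal_operator N (extension (act (coordinate \<Omega> i)))" for i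
    using ess coordinate_in_domain_algebra
    by (intro normal_extension act) (auto simp: essentially_normal_module_def coordinate_op_def Let_def)
  moreover have "extension (act (coordinate \<Omega> i)) (extension (act (coordinate \<Omega> j)) y) =
      extension (act (coordinate \<Omega> j)) (extension (act (coordinate \<Omega> i)) y)" if "y \<in> N" for i j y
  proof -
    have "alg_mult \<Omega> (coordinate \<Omega> i) (coordinate \<Omega> j) = alg_mult \<Omega> (coordinate \<Omega> j) (coordinate \<Omega> i)"
      by (simp add: alg_mult_def mult.commute)
    then show ?thesis using mult[OF coordinate_in_domain_algebra coordinate_in_domain_algebra that] by metis
  qed
  ultimately show ?thesis
    by (simp add: normal_module_def coordinate_op_def Let_def)
qed

text \<open>The copy of \<open>R\<close> at level 0 is the submodule: \<open>lift 0\<close> is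
  isometric and carries each operator to its extension.\<close>

lemma (in pure_isometry) submodule_extension:
  assumes act: "\<And>f. f \<in> domain_algebra \<Omega> \<Longrightarrow> intertwiner (act f)"
  shows "is_submodule \<Omega> R act N (\<lambda>f. extension (act f))"
  unfolding is_submodule_def
proof (intro exI[of _ "lift 0 ` R"] exI[of _ "lift 0"] conjI ballI)
  show "lift 0 ` R \<subseteq> N" using lift_N by blast
  show "csubspace (lift 0 ` R)"
    unfolding csubspace_def
  proof (intro conjI ballI allI)
    show "0 \<in> lift 0 ` R"
      using clinear_betw_zero[OF lift_lin R(1), of 0] csubspace_zero[OF R(1)] by force
  next
    fix y z assume "y \<in> lift 0 ` R" "z \<in> lift 0 ` R"
    then show "y + z \<in> lift 0 ` R"
      using csubspace_add[OF R(1)] by (auto simp flip: clinear_betw_add[OF lift_lin])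
  next
    fix c y assume "y \<in> lift 0 ` R"
    then show "c *\<^sub>C y \<in> lift 0 ` R"
      using csubspace_scaleC[OF R(1)] by (auto simp flip: clinear_betw_scaleC[OF lift_lin])
  qed
  show "closed (lift 0 ` R)" by (rule closed_isometric_image[OF lift_lin lift_isometric R])
  show "clinear_betw R (lift 0 ` R) (lift 0)" using lift_lin[of 0] by (auto simp: clinear_betw_def)
  show "isometric_on R (lift 0)" by (rule lift_isometric)
  have "inj_on (lift 0) R"
  proof (rule inj_onI)
    fix x y assume xy: "x \<in> R" "y \<in> R" "lift 0 x = lift 0 y"
    then have "norm (lift 0 (x - y)) = 0" by (simp add: clinear_betw_diff[OF lift_lin R(1)])
    then show "x = y" using xy by (simp add: norm_lift csubspace_diff[OF R(1)])
  qed
  then show "bij_betw (lift 0) R (lift 0 ` R)" by (simp add: bij_betw_def)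
next
  fix f y assume f: "f \<in> domain_algebra \<Omega>" and "y \<in> lift 0 ` R"
  then show "extension (act f) y \<in> lift 0 ` R"
    by (auto simp: extension_lift[OF act] intertwiner_mem[OF act])
next
  fix f x assume "f \<in> domain_algebra \<Omega>" "x \<in> R"
  then show "lift 0 (act f x) = extension (act f) (lift 0 x)"
    by (simp add: extension_lift[OF act])
qed

theorem theorem9p2:
  fixes \<Omega> :: "(complex ^ 'n) set"
    and R :: "'a :: chilbert_space set"
    and act :: "(complex ^ 'n \<Rightarrow> complex) \<Rightarrow> 'a \<Rightarrow> 'a"
    and U :: "'a \<Rightarrow> 'a"
  assumes "bounded_domain \<Omega>"
    and "essentially_normal_module \<Omega> R act"
    and "module_map \<Omega> R act U"
    and "isometric_on R U"
    and "(\<Inter>k. (U ^^ k) ` R) = {0}"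
  shows "subnormal_module \<Omega> R act"
proof -
  have mod: "hilbert_module \<Omega> R act" using assms(2) by (simp add: essentially_normal_module_def)
  interpret pure_isometry R U
    using mod assms(3-5) by unfold_locales (simp_all add: hilbert_module_def module_map_def)
  have "is_submodule \<Omega> R act N (\<lambda>f. extension (act f))"
    by (rule submodule_extension[OF intertwiner_act[OF mod assms(3)]])
  then show ?thesis
    unfolding subnormal_module_def using normal_module_extension[OF assms(2,3)] by blast
qed

end
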